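(* Let $m,n,r,s,t$ be positive integers with $1 \leq t \leq r \leq s$, and let $u$ be a non-negative real number such that $u > \frac{6-t}{3}$. Suppose $\min\{m,n\} \geq (t+u+1)(s-t)+r-t$. If $\mathcal{A} \subseteq M_{m,r}$, $\mathcal{B} \subseteq M_{n,s}$, and $\mathcal{A}$ and $\mathcal{B}$ are cross-$t$-intersecting, then \[|\mathcal{A}||\mathcal{B}| \leq \binom{m+r-t-1}{r-t}\binom{n+s-t-1}{s-t}.\] Moreover, if $u > 0$, then the bound is attained if and only if $\mathcal{A} = \left\{ A \in M_{m,r} : T \subseteq \mathrm{S}_A \right\}$ and $\mathcal{B} = \left\{ B \in M_{n,s} : T \subseteq \mathrm{S}_B \right\}$ for some $t$-element subset $T$ of $[\min\{m,n\}]$.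
   Context: $[n]=\{1,\dots,n\}$. Multisets of positive integers are represented by increasing (weakly) sequences: for positive integers $n,r$, $M_{n,r} = \{(a_1,\dots,a_r) : a_1 \leq \dots \leq a_r,\ a_1,\dots,a_r \in [n]\}$. The support of $A=(a_1,\dots,a_r)$ is the set $\mathrm{S}_A = \{a_1,\dots,a_r\}$. Two sets $\mathcal{A}$ and $\mathcal{B}$ of multisets (possibly empty) are cross-$t$-intersecting if $|\mathrm{S}_A \cap \mathrm{S}_B| \geq t$ for every $A \in \mathcal{A}$ and every $B \in \mathcal{B}$ (i.e. $A$ and $B$ have at least $t$ distinct common elements). *)

theory Defs
  imports Complex_Main
begin

(* Multisets of cardinality r with elements in [n] = {1..n}, represented by weakly increasing
   sequences; the support of a multiset A is then "set A". *)
definition multisets :: "nat \<Rightarrow> nat \<Rightarrow> nat list set" where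
  "multisets n r = {a. length a = r \<and> sorted a \<and> set a \<subseteq> {1..n}}"

definition cross_intersecting :: "nat \<Rightarrow> nat list set \<Rightarrow> nat list set \<Rightarrow> bool" where
  "cross_intersecting t \<A> \<B> \<longleftrightarrow> (\<forall>A\<in>\<A>. \<forall>B\<in>\<B>. card (set A \<inter> set B) \<ge> t)"

end

theory Submission
  imports Defs
begin

text \<open>The condition on \<open>\<A>\<close> and \<open>\<B>\<close> only concerns supports, so every family of multisets may
be replaced by its family of supports, a set \<open>S\<close> counted with weight \<open>(r - 1) choose (card S - 1)\<close>, the number
of multisets of size \<open>r\<close> with support \<open>S\<close>. This weight depends on the size of \<open>S\<close> alone, so that
shifting (replacing \<open>j\<close> by a smaller \<open>i\<close> wherever possible) preserves all weights as well as the
crossing condition (lemmas \<open>weight_shift_family\<close>, \<open>crossing_shift_family\<close>). Hence it is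
enough to study shifted pairs.

Let \<open>l\<close> be least such that any two sets, one from each family, share \<open>t\<close> elements of \<open>{1..l}\<close>.
If \<open>l \<le> t\<close>, all sets contain \<open>{1..t}\<close> and the bound is the weight of the two stars. Suppose \<open>t < l\<close>.
The pair may then be described by the traces of its sets on \<open>{1..l}\<close>, where a trace \<open>E\<close> carries the total weight
of all sets with that trace. By Vandermonde's identity this is a binomial coefficient, and the hypothesis on \<open>min m n\<close>
says that deleting an element from a relevant trace multiplies its weight by at least \<open>c = t + u\<close>.

Call \<open>(E, F)\<close> critical if \<open>E\<close> and \<open>F\<close> no longer share \<open>t\<close> elements once \<open>l\<close> is removed. Because of shiftedness,
\<open>E \<union> F = {1..l}\<close> and \<open>card E + card F = l + t\<close> (lemma \<open>critical_pair\<close>). So one may delete \<open>l\<close> from all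
traces of size \<open>i\<close> for which this gives a new trace, at the price of losing the corresponding ones of size \<open>l + t - i\<close>
on the other side. In a pair of
maximum product none of these exchanges is profitable. Comparing the two
opposite exchanges shows that these traces of size \<open>i\<close> carry all but a fraction \<open>1 / c\<close> of the mass
(lemma \<open>layer_large\<close>), whereas shiftedness bounds their share by \<open>i / l\<close> (lemma \<open>layer_double_count\<close>). Together:
\<open>c * (l - i) \<le> l\<close>, and likewise on the other side, whence \<open>c * (l - t) \<le> 2 * l\<close>.
For \<open>l \<ge> t + 3\<close> this gives \<open>c \<le> 2 * (t + 3) / 3\<close>, which is exactly what \<open>u > (6 - t) / 3\<close> excludes.
The remaining cases, \<open>l = t + 2\<close> with all critical traces of size \<open>t + 1\<close>, and a
critical trace of the minimal size \<open>t\<close>, are settled by two further exchanges. They produce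
a pair of no smaller product that already shares \<open>t\<close> elements of \<open>{1..l - 1}\<close>, and of strictly larger product
if \<open>u > 0\<close> (lemma \<open>improvable\<close>). Choosing a pair of maximum product with least \<open>l\<close> proves the bound.

For \<open>u > 0\<close>, a shifted pair attaining the bound consists of the stars of \<open>{1..t}\<close>. Undoing one shift preserves
the property of being a pair of stars: since the shifted family contains a set of size \<open>t\<close>, so does the original one, and a member
of size \<open>t\<close> must be contained in every set of the other family (lemma \<open>stars_if_small_member\<close>).\<close>

section \<open>Multisets with a given support\<close>

definition supports :: "nat \<Rightarrow> nat \<Rightarrow> nat set set" where
  "supports m r = {S. S \<subseteq> {1..m} \<and> S \<noteq> {} \<and> card S \<le> r}"

definition weight :: "nat \<Rightarrow> nat set set \<Rightarrow> nat" where
  "weight r \<F> = (\<Sum>S\<in>\<F>. (r - 1) choose (card S - 1))"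

lemma finite_supports: "finite (supports m r)"
  by (rule finite_subset[of _ "Pow {1..m}"]) (auto simp: supports_def)

lemma supports_finite: "S \<in> supports m r \<Longrightarrow> finite S"
  by (auto simp: supports_def intro: finite_subset)

definition sorted_lists :: "nat \<Rightarrow> nat set \<Rightarrow> nat list set" where
  "sorted_lists r S = {a. length a = r \<and> sorted a \<and> set a = S}"

text \<open>A nondecreasing list with entry set \<open>S\<close> starts with \<open>Min S\<close>, and \<open>Min S\<close> may or may not occur again;
counting the two cases gives Pascal's rule.\<close>

lemma sorted_lists_Suc:
  assumes "finite S" "S \<noteq> {}"
  shows "sorted_lists (Suc r) S = (#) (Min S) ` (sorted_lists r S \<union> sorted_lists r (S - {Min S}))"
proof (intro equalityI subsetI)
  fix a assume "a \<in> sorted_lists (Suc r) S"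
  then obtain x b where a: "a = x # b" and b: "length b = r" "sorted b" "\<forall>y\<in>set b. x \<le> y"
    "insert x (set b) = S"
    by (cases a) (auto simp: sorted_lists_def)
  have x: "x = Min S"
    using b(3,4) by (intro Min_eqI[symmetric]) (use assms in auto)
  have "set b = S \<or> set b = S - {x}" using b(4) by (cases "x \<in> set b") auto
  then have "b \<in> sorted_lists r S \<union> sorted_lists r (S - {Min S})"
    using b(1,2) unfolding x sorted_lists_def by blast
  then show "a \<in> (#) (Min S) ` (sorted_lists r S \<union> sorted_lists r (S - {Min S}))"
    unfolding a x by (rule imageI)
next
  fix a assume "a \<in> (#) (Min S) ` (sorted_lists r S \<union> sorted_lists r (S - {Min S}))"
  then obtain b where b: "a = Min S # b" "length b = r" "sorted b" "set b = S \<or> set b = S - {Min S}"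
    unfolding sorted_lists_def by blast
  have "insert (Min S) (set b) = S" using b(4) Min_in[OF assms] by blast
  moreover have "\<forall>y\<in>set b. Min S \<le> y" using b(4) assms(1) by (metis DiffD1 Min_le)
  ultimately show "a \<in> sorted_lists (Suc r) S"
    unfolding b(1) sorted_lists_def using b(2,3) by simp
qed

lemma finite_sorted_lists:
  fixes S :: "nat set"
  shows "finite S \<Longrightarrow> finite (sorted_lists r S)"
  by (rule finite_subset[OF _ finite_lists_length_eq[of S r]]) (auto simp: sorted_lists_def)

lemma card_sorted_lists_with_set:
  fixes S :: "nat set"
  assumes "finite S" "S \<noteq> {}"
  shows "card (sorted_lists (Suc r) S) = r choose (card S - 1)"
  using assms
proof (induction r arbitrary: S)
  case 0
  have "sorted_lists (Suc 0) S = (if card S = 1 then {[Min S]} else {})"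
    using 0 by (auto simp: sorted_lists_def length_Suc_conv card_1_singleton_iff)
  moreover have "card S \<noteq> 0" using 0 by simp
  ultimately show ?case by (auto simp: binomial_eq_0_iff)
next
  case (Suc r)
  let ?L = "sorted_lists (Suc r)"
  have ne: "S \<noteq> S - {Min S}" using Min_in Suc.prems by blast
  have "card (sorted_lists (Suc (Suc r)) S) = card (?L S \<union> ?L (S - {Min S}))"
    unfolding sorted_lists_Suc[OF Suc.prems] by (intro card_image) (auto simp: inj_on_def)
  also have "\<dots> = card (?L S) + card (?L (S - {Min S}))"
  proof (intro card_Un_disjoint finite_sorted_lists finite_Diff Suc.prems(1))
    show "?L S \<inter> ?L (S - {Min S}) = {}" using ne unfolding sorted_lists_def by blast
  qed
  also have "\<dots> = Suc r choose (card S - 1)"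
  proof (cases "S - {Min S} = {}")
    case True
    then have "S = {Min S}" using Suc.prems by auto
    then have "card S = 1" by (metis is_singletonI is_singleton_altdef)
    moreover have "?L (S - {Min S}) = {}" unfolding True by (auto simp: sorted_lists_def)
    ultimately show ?thesis unfolding Suc.IH[OF Suc.prems] by (simp only:) simp
  next
    case False
    have c: "card (S - {Min S}) = card S - 1" using Suc.prems by simp
    moreover have "card (S - {Min S}) \<noteq> 0"
      unfolding card_eq_0_iff using False Suc.prems(1) by blast
    ultimately obtain k where k: "card S - 1 = Suc k" by (cases "card S - 1") auto
    have "card (?L S) = r choose Suc k" using Suc.IH[OF Suc.prems] k by simp
    moreover have "card (?L (S - {Min S})) = r choose k"
      unfolding Suc.IH[OF finite_Diff[OF Suc.prems(1)] False] c k by simp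
    ultimately show ?thesis unfolding k by (simp only: binomial_Suc_Suc add.commute)
  qed
  finally show ?case .
qed

lemma card_multisets_with_support_in:
  assumes "1 \<le> r" "\<F> \<subseteq> supports m r"
  shows "card {A \<in> multisets m r. set A \<in> \<F>} = weight r \<F>"
proof -
  let ?L = "sorted_lists r"
  have "{A \<in> multisets m r. set A \<in> \<F>} = (\<Union>S\<in>\<F>. ?L S)"
    using assms(2) by (auto simp: multisets_def supports_def sorted_lists_def)
  moreover have "card (\<Union>S\<in>\<F>. ?L S) = (\<Sum>S\<in>\<F>. card (?L S))"
  proof (rule card_UN_disjoint)
    show "finite \<F>" using finite_subset[OF assms(2) finite_supports] .
    show "\<forall>S\<in>\<F>. finite (?L S)" using assms(2) by (intro ballI finite_sorted_lists) (blast intro: supports_finite)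
    show "\<forall>S\<in>\<F>. \<forall>S'\<in>\<F>. S \<noteq> S' \<longrightarrow> ?L S \<inter> ?L S' = {}" unfolding sorted_lists_def by blast
  qed
  moreover have "(\<Sum>S\<in>\<F>. card (?L S)) = weight r \<F>"
    unfolding weight_def
  proof (rule sum.cong)
    fix S assume "S \<in> \<F>"
    then have "S \<in> supports m r" using assms(2) by blast
    then have "finite S" "S \<noteq> {}" using supports_finite[of S m r] by (auto simp: supports_def)
    then show "card (?L S) = (r - 1) choose (card S - 1)"
      using card_sorted_lists_with_set[of S "r - 1"] unfolding Suc_diff_1[OF assms(1)[unfolded One_nat_def Suc_le_eq]]
      by blast
  qed simp
  ultimately show ?thesis by simp
qed

lemma finite_multisets: "finite (multisets m r)"
  by (rule finite_subset[OF _ finite_lists_length_eq[of "{1..m}" r]]) (auto simp: multisets_def)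

lemma set_in_supports:
  "A \<in> multisets m r \<Longrightarrow> 1 \<le> r \<Longrightarrow> set A \<in> supports m r"
  by (auto simp: multisets_def supports_def card_length)

lemma weight_mono: "\<F> \<subseteq> \<G> \<Longrightarrow> \<G> \<subseteq> supports m r \<Longrightarrow> weight r \<F> \<le> weight r \<G>"
  unfolding weight_def by (intro sum_mono2) (auto intro: finite_subset[OF _ finite_supports])

text \<open>All weights are positive, so equality of weights forces equality of nested families.\<close>

lemma weight_subset_eq:
  assumes "\<F> \<subseteq> \<G>" "\<G> \<subseteq> supports m r" "weight r \<G> \<le> weight r \<F>"
  shows "\<F> = \<G>"
proof (rule ccontr)
  assume "\<F> \<noteq> \<G>"
  then obtain S where S: "S \<in> \<G>" "S \<notin> \<F>" using assms(1) by blast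
  have fin: "finite \<G>" using finite_subset[OF assms(2) finite_supports] .
  have "S \<in> supports m r" using S assms(2) by blast
  then have "1 \<le> card S" "card S \<le> r"
    using supports_finite[of S m r] by (auto simp: supports_def Suc_le_eq card_gt_0_iff)
  then have "0 < (r - 1) choose (card S - 1)" by simp
  moreover have "weight r (insert S \<F>) = ((r - 1) choose (card S - 1)) + weight r \<F>"
    unfolding weight_def using S finite_subset[OF assms(1) fin] by simp
  moreover have "weight r (insert S \<F>) \<le> weight r \<G>"
    using assms S by (intro weight_mono) auto
  ultimately show False using assms(3) by linarith
qed

section \<open>The weight of all supports with a given trace\<close>

lemma sum_Pow_insert:
  assumes "finite X" "x \<notin> X"
  shows "(\<Sum>D\<in>Pow (insert x X). f D) = (\<Sum>D\<in>Pow X. f D) + (\<Sum>D\<in>Pow X. f (insert x D) :: nat)"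
proof -
  have "(\<Sum>D\<in>Pow (insert x X). f D) = (\<Sum>D\<in>Pow X. f D) + (\<Sum>D\<in>insert x ` Pow X. f D)"
    unfolding Pow_insert by (intro sum.union_disjoint) (use assms in auto)
  also have "(\<Sum>D\<in>insert x ` Pow X. f D) = (\<Sum>D\<in>Pow X. f (insert x D))"
  proof (subst sum.reindex)
    show "inj_on (insert x) (Pow X)"
      by (intro inj_onI) (metis assms(2) Diff_insert_absorb PowD subsetD)
  qed simp
  finally show ?thesis .
qed

text \<open>An instance of Vandermonde's identity: adding an element to \<open>X\<close> splits the sum according to Pascal's rule.\<close>

lemma sum_choose_over_subsets:
  assumes "finite X" "1 \<le> e" "1 \<le> r"
  shows "(\<Sum>D\<in>Pow X. (r - 1) choose (e + card D - 1)) =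
    (if e \<le> r then (card X + r - 1) choose (r - e) else 0)"
  using assms
proof (induction X arbitrary: e rule: finite_induct)
  case empty
  have "((r - 1) choose (e - 1)) = ((r - 1) choose (r - e))" if "e \<le> r"
    using binomial_symmetric[of "e - 1" "r - 1"] that empty by simp
  moreover have "((r - 1) choose (e - 1)) = 0" if "\<not> e \<le> r"
    using that empty by (simp add: binomial_eq_0_iff)
  ultimately show ?case by simp
next
  case (insert x X)
  have "(\<Sum>D\<in>Pow X. (r - 1) choose (e + card (insert x D) - 1))
      = (\<Sum>D\<in>Pow X. (r - 1) choose (Suc e + card D - 1))"
  proof (rule sum.cong)
    fix D assume "D \<in> Pow X"
    then have "finite D" "x \<notin> D" using insert finite_subset by auto
    then show "((r - 1) choose (e + card (insert x D) - 1)) = ((r - 1) choose (Suc e + card D - 1))"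
      by simp
  qed simp
  then have eq: "(\<Sum>D\<in>Pow (insert x X). (r - 1) choose (e + card D - 1)) =
     (if e \<le> r then (card X + r - 1) choose (r - e) else 0)
     + (if Suc e \<le> r then (card X + r - 1) choose (r - Suc e) else 0)"
    using insert.IH[of e] insert.IH[of "Suc e"] insert.prems
    by (simp only: sum_Pow_insert[OF insert.hyps])
  show ?case
  proof (cases "Suc e \<le> r")
    case True
    then obtain k where k: "r - e = Suc k" "r - Suc e = k" by (metis Suc_diff_Suc Suc_le_lessD)
    have c: "card (insert x X) + r - 1 = Suc (card X + r - 1)" using insert True by simp
    have "e \<le> r" using True by simp
    then show ?thesis unfolding eq k c
      by (simp only: True if_True binomial_Suc_Suc add.commute)
  qed (use eq insert in auto)
qed

text \<open>The common weight of all families of sets that have a prescribed trace of size \<open>i\<close> on a fixed set of size \<open>l\<close>. Traces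
of size above \<open>r\<close> do not occur; the case distinction is needed since the subtraction \<open>r - i\<close> is truncated.\<close>

definition trace_weight :: "nat \<Rightarrow> nat \<Rightarrow> nat \<Rightarrow> nat \<Rightarrow> nat" where
  "trace_weight m r l i = (if i \<le> r then (m - l + r - 1) choose (r - i) else 0)"

lemma weight_with_trace:
  assumes "L \<subseteq> {1..m}" "E \<subseteq> L" "E \<noteq> {}" "1 \<le> r"
  shows "weight r {S \<in> supports m r. S \<inter> L = E} = trace_weight m r (card L) (card E)"
proof -
  let ?X = "{1..m} - L"
  have fE: "finite L" "finite E" using finite_subset[OF assms(1)] finite_subset[OF assms(2)] by auto
  have e: "1 \<le> card E" using assms fE by (simp add: Suc_le_eq card_gt_0_iff)
  have cD: "card (E \<union> D) = card E + card D" if "D \<in> Pow ?X" for D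
    using that assms fE by (intro card_Un_disjoint) (auto intro: finite_subset)
  have "weight r {S \<in> supports m r. S \<inter> L = E}
      = (\<Sum>S\<in>(\<union>) E ` Pow ?X. (r - 1) choose (card S - 1))"
    unfolding weight_def
  proof (rule sum.mono_neutral_left)
    show "finite ((\<union>) E ` Pow ?X)" by simp
    show "{S \<in> supports m r. S \<inter> L = E} \<subseteq> (\<union>) E ` Pow ?X"
    proof
      fix S assume "S \<in> {S \<in> supports m r. S \<inter> L = E}"
      then have "S = E \<union> (S - L)" "S - L \<in> Pow ?X" unfolding supports_def by blast+
      then show "S \<in> (\<union>) E ` Pow ?X" by blast
    qed
    \<comment> \<open>Sets with more than \<open>r\<close> elements may be included, their binomial coefficient vanishes.\<close>
    show "\<forall>S\<in>(\<union>) E ` Pow ?X - {S \<in> supports m r. S \<inter> L = E}. ((r - 1) choose (card S - 1)) = 0"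
    proof
      fix S assume S: "S \<in> (\<union>) E ` Pow ?X - {S \<in> supports m r. S \<inter> L = E}"
      then obtain D where D: "D \<in> Pow ?X" "S = E \<union> D" by blast
      then have "S \<subseteq> {1..m}" "S \<inter> L = E" "S \<noteq> {}" using assms(1-3) by blast+
      then have "r < card S" using S unfolding supports_def by (metis (mono_tags, lifting) DiffD2 mem_Collect_eq not_le)
      then show "((r - 1) choose (card S - 1)) = 0" using assms(4) by (simp add: binomial_eq_0_iff)
    qed
  qed
  also have "\<dots> = (\<Sum>D\<in>Pow ?X. (r - 1) choose (card (E \<union> D) - 1))"
  proof (subst sum.reindex)
    have "D = (E \<union> D) - L" if "D \<in> Pow ?X" for D using that assms(2) by auto
    then show "inj_on ((\<union>) E) (Pow ?X)" by (rule inj_on_inverseI[OF sym])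
  qed simp
  also have "\<dots> = (\<Sum>D\<in>Pow ?X. (r - 1) choose (card E + card D - 1))"
    by (rule sum.cong) (simp_all add: cD)
  also have "\<dots> = trace_weight m r (card L) (card E)"
    unfolding trace_weight_def using e assms fE
    by (subst sum_choose_over_subsets) (auto simp: card_Diff_subset)
  finally show ?thesis .
qed

definition star :: "nat \<Rightarrow> nat \<Rightarrow> nat set \<Rightarrow> nat set set" where
  "star m r T = {S \<in> supports m r. T \<subseteq> S}"

lemma weight_star:
  assumes "T \<subseteq> {1..m}" "T \<noteq> {}" "card T \<le> r" "1 \<le> r"
  shows "weight r (star m r T) = (m + r - card T - 1) choose (r - card T)"
proof -
  have "star m r T = {S \<in> supports m r. S \<inter> T = T}" by (auto simp: star_def)
  moreover have "card T \<le> m" using card_mono[OF _ assms(1)] by simp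
  ultimately show ?thesis using weight_with_trace[OF assms(1) order.refl assms(2), of r] assms
    by (simp add: trace_weight_def)
qed

lemma trace_weight_pos: "1 \<le> i \<Longrightarrow> i \<le> r \<Longrightarrow> 0 < trace_weight m r l i"
  by (auto simp: trace_weight_def)

text \<open>The ratio of consecutive binomial coefficients is \<open>(m - l + i - 1) / (r - i + 1)\<close>.\<close>

lemma trace_weight_ratio:
  assumes "1 < i" "i \<le> r" "l \<le> m" "(c::real) \<ge> 0"
    and "c * (real r - real i + 1) \<le> real m - real l + real i - 1"
  shows "c * trace_weight m r l i \<le> trace_weight m r l (i - 1)"
proof -
  define P q where "P = m - l + r - 1" and "q = r - i"
  have q: "r - (i - 1) = Suc q" using assms by (simp add: q_def)
  have "Suc q * (P choose Suc q) = (P - q) * (P choose q)"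
    using binomial_absorb_comp[of P q] binomial_absorption[of q P]
    by (cases P) (auto simp: algebra_simps)
  then have "real (Suc q) * real (P choose Suc q) = real (P - q) * real (P choose q)"
    by (metis of_nat_mult)
  moreover have "c * real (Suc q) \<le> real (P - q)"
    using assms by (simp add: P_def q_def of_nat_diff algebra_simps)
  ultimately have "(c * real (P choose q)) * real (Suc q) \<le> real (P choose Suc q) * real (Suc q)"
    using mult_right_mono[of "c * real (Suc q)" "real (P - q)" "real (P choose q)"]
    by (simp add: algebra_simps)
  then have "c * real (P choose q) \<le> real (P choose Suc q)"
    by (rule mult_right_le_imp_le) simp
  moreover have "i - 1 \<le> r" using assms(2) by simp
  ultimately show ?thesis using assms(2) q by (simp add: trace_weight_def P_def q_def)
qed

section \<open>Shifting\<close>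

definition shift :: "nat \<Rightarrow> nat \<Rightarrow> nat set \<Rightarrow> nat set" where
  "shift i j S = (if j \<in> S \<and> i \<notin> S then insert i (S - {j}) else S)"

text \<open>A set stays in place if its image is already present; this makes the shift of a family injective.\<close>

definition shift_within :: "nat set set \<Rightarrow> nat \<Rightarrow> nat \<Rightarrow> nat set \<Rightarrow> nat set" where
  "shift_within \<F> i j S = (if shift i j S \<in> \<F> then S else shift i j S)"

definition shift_family :: "nat \<Rightarrow> nat \<Rightarrow> nat set set \<Rightarrow> nat set set" where
  "shift_family i j \<F> = shift_within \<F> i j ` \<F>"

definition shifted :: "nat set set \<Rightarrow> bool" where
  "shifted \<F> \<longleftrightarrow> (\<forall>i j. \<forall>S\<in>\<F>. 1 \<le> i \<and> i < j \<longrightarrow> shift i j S \<in> \<F>)"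

text \<open>Only common elements up to \<open>l\<close> count; the least possible \<open>l\<close> measures how far a pair is from
a pair of stars.\<close>

definition crossing :: "nat \<Rightarrow> nat \<Rightarrow> nat set set \<Rightarrow> nat set set \<Rightarrow> bool" where
  "crossing l t \<F> \<G> \<longleftrightarrow> (\<forall>A\<in>\<F>. \<forall>B\<in>\<G>. t \<le> card (A \<inter> B \<inter> {1..l}))"

lemma crossing_sym: "crossing l t \<F> \<G> \<Longrightarrow> crossing l t \<G> \<F>"
  unfolding crossing_def by (metis Int_commute)

lemma card_shift: "finite S \<Longrightarrow> card (shift i j S) = card S"
  by (auto simp: shift_def card_Suc_Diff1 simp del: card_Diff_insert card_Diff_singleton)

lemma card_shift_within: "finite S \<Longrightarrow> card (shift_within \<F> i j S) = card S"
  by (simp add: shift_within_def card_shift)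

lemma shift_supports: "S \<in> supports m r \<Longrightarrow> 1 \<le> i \<Longrightarrow> i < j \<Longrightarrow> shift i j S \<in> supports m r"
  using card_shift[OF supports_finite, of S m r i j] by (auto simp: supports_def shift_def)

lemma shift_family_supports:
  "\<F> \<subseteq> supports m r \<Longrightarrow> 1 \<le> i \<Longrightarrow> i < j \<Longrightarrow> shift_family i j \<F> \<subseteq> supports m r"
  by (auto simp: shift_family_def shift_within_def intro: shift_supports)

lemma inj_on_shift_within:
  assumes "i \<noteq> j"
  shows "inj_on (shift_within \<F> i j) \<F>"
proof (rule inj_onI)
  fix S S' assume S: "S \<in> \<F>" "S' \<in> \<F>" and eq: "shift_within \<F> i j S = shift_within \<F> i j S'"
  have undo: "X = insert j (shift i j X - {i})" if "shift i j X \<noteq> X" for X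
    using that assms by (auto simp: shift_def split: if_splits)
  consider "shift i j S \<in> \<F>" "shift i j S' \<in> \<F>" | "shift i j S \<notin> \<F>" "shift i j S' \<notin> \<F>"
    using eq S unfolding shift_within_def by (metis (full_types))
  then show "S = S'"
  proof cases
    case 1 then show ?thesis using eq by (simp add: shift_within_def)
  next
    case 2
    then have "shift i j S = shift i j S'" "shift i j S \<noteq> S" "shift i j S' \<noteq> S'"
      using eq S by (auto simp: shift_within_def)
    then show ?thesis using undo[of S] undo[of S'] by argo
  qed
qed

lemma weight_shift_family:
  assumes "\<F> \<subseteq> supports m r" "i \<noteq> j"
  shows "weight r (shift_family i j \<F>) = weight r \<F>"
  unfolding weight_def shift_family_def
proof (subst sum.reindex[OF inj_on_shift_within[OF assms(2)]], rule sum.cong)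
  fix S assume "S \<in> \<F>"
  then have "finite S" using assms(1) supports_finite by blast
  then show "((\<lambda>S. (r - 1) choose (card S - 1)) \<circ> shift_within \<F> i j) S = ((r - 1) choose (card S - 1))"
    by (simp add: card_shift_within)
qed simp

lemma finite_meet [simp]: "finite (A \<inter> B \<inter> {1..l::nat})"
  by simp

text \<open>The intersection loses \<open>j\<close> (if at all) but gains the smaller element \<open>i\<close>, which lies in \<open>{1..l}\<close> if \<open>j\<close> does.\<close>

lemma card_meet_shift_both:
  fixes i j l :: nat
  assumes "i < j" "1 \<le> i" "j \<in> A" "i \<notin> A" "j \<in> B"
  shows "card (A \<inter> B \<inter> {1..l}) \<le> card (insert i (A - {j}) \<inter> insert i B \<inter> {1..l})"
proof (cases "j \<le> l")
  case True
  then have "i \<le> l" using assms(1) by simp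
  have "insert i (A - {j}) \<inter> insert i B \<inter> {1..l} = insert i (A \<inter> B \<inter> {1..l} - {j})"
    using assms True \<open>i \<le> l\<close> by auto
  moreover have "card (insert i (A \<inter> B \<inter> {1..l} - {j})) = card (A \<inter> B \<inter> {1..l})"
    using assms True card_Suc_Diff1[of "A \<inter> B \<inter> {1..l}" j] by (subst card_insert_disjoint) auto
  ultimately show ?thesis by simp
next
  case False
  then show ?thesis by (intro card_mono) auto
qed

text \<open>What a moved set loses in the intersection is regained at \<^term>\<open>i\<close>, unless the other set stayed
in place because its own image was already present; then the original set is compared with that image.\<close>

lemma card_meet_shift_within:
  assumes ij: "1 \<le> i" "i < j" and cr: "crossing l t \<F> \<G>"
    and A: "A \<in> \<F>" "shift i j A \<notin> \<F>" and B: "B \<in> \<G>"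
  shows "t \<le> card (shift i j A \<inter> shift_within \<G> i j B \<inter> {1..l})"
proof -
  have A': "j \<in> A" "i \<notin> A" "shift i j A = insert i (A - {j})" using A by (auto simp: shift_def split: if_splits)
  have AB: "t \<le> card (A \<inter> B \<inter> {1..l})" using cr A B by (auto simp: crossing_def)
  consider (both) "shift i j B \<notin> \<G>" | (out) "shift i j B \<in> \<G>" "j \<notin> B"
    | (inn) "shift i j B \<in> \<G>" "j \<in> B" "i \<in> B" | (image) "shift i j B \<in> \<G>" "j \<in> B" "i \<notin> B"
    by blast
  then show ?thesis
  proof cases
    case both
    then have B': "j \<in> B" "i \<notin> B" "shift i j B = insert i (B - {j})" using B by (auto simp: shift_def split: if_splits)
    have "insert i (A - {j}) \<inter> insert i B \<inter> {1..l} = shift i j A \<inter> shift_within \<G> i j B \<inter> {1..l}"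
      using both A' B' by (auto simp: shift_within_def)
    then show ?thesis using card_meet_shift_both[OF ij(2,1) A'(1,2) B'(1), of l] AB by simp
  next
    case out
    have "A \<inter> B \<inter> {1..l} \<subseteq> shift i j A \<inter> shift_within \<G> i j B \<inter> {1..l}"
      using out A' by (auto simp: shift_within_def)
    then show ?thesis using AB card_mono[OF finite_meet] order_trans by blast
  next
    case inn
    then have "insert i (A - {j}) \<inter> insert i B \<inter> {1..l} = shift i j A \<inter> shift_within \<G> i j B \<inter> {1..l}"
      using A' by (auto simp: shift_within_def)
    then show ?thesis using card_meet_shift_both[OF ij(2,1) A'(1,2) inn(2), of l] AB by simp
  next
    case image
    have "A \<inter> shift i j B \<inter> {1..l} = shift i j A \<inter> shift_within \<G> i j B \<inter> {1..l}"
      using image A' by (auto simp: shift_within_def shift_def)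
    moreover have "t \<le> card (A \<inter> shift i j B \<inter> {1..l})" using cr A(1) image(1) by (auto simp: crossing_def)
    ultimately show ?thesis by simp
  qed
qed

lemma crossing_shift_family:
  assumes "1 \<le> i" "i < j" "crossing l t \<F> \<G>"
  shows "crossing l t (shift_family i j \<F>) (shift_family i j \<G>)"
  unfolding crossing_def shift_family_def
proof (intro ballI, elim imageE, simp only:)
  fix A B assume AB: "A \<in> \<F>" "B \<in> \<G>"
  consider "shift i j A \<notin> \<F>" | "shift i j B \<notin> \<G>" | "shift i j A \<in> \<F>" "shift i j B \<in> \<G>" by blast
  then show "t \<le> card (shift_within \<F> i j A \<inter> shift_within \<G> i j B \<inter> {1..l})"
  proof cases
    case 1
    then show ?thesis using card_meet_shift_within[OF assms AB(1) 1 AB(2)] by (simp add: shift_within_def)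
  next
    case 2
    then show ?thesis
      using card_meet_shift_within[OF assms(1,2) crossing_sym[OF assms(3)] AB(2) 2 AB(1)]
      by (simp add: shift_within_def Int_commute)
  next
    case 3
    then show ?thesis using assms(3) AB by (simp add: shift_within_def crossing_def)
  qed
qed

text \<open>Every proper shift decreases this quantity, so repeated shifting terminates.\<close>

definition total :: "nat set set \<Rightarrow> nat" where
  "total \<F> = (\<Sum>S\<in>\<F>. \<Sum>S)"

lemma sum_shift_less: "finite S \<Longrightarrow> i < j \<Longrightarrow> shift i j S \<noteq> S \<Longrightarrow> \<Sum>(shift i j S) < \<Sum>S"
  using sum.remove[of S j "\<lambda>x. x"] by (auto simp: shift_def split: if_splits)

lemma total_shift_family:
  assumes "\<F> \<subseteq> supports m r" "i < j"
  shows "total (shift_family i j \<F>) \<le> total \<F>"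
    and "S \<in> \<F> \<Longrightarrow> shift i j S \<notin> \<F> \<Longrightarrow> total (shift_family i j \<F>) < total \<F>"
proof -
  have fin: "finite \<F>" using finite_subset[OF assms(1) finite_supports] .
  have finS: "finite S" if "S \<in> \<F>" for S using that assms(1) supports_finite by blast
  have eq: "total (shift_family i j \<F>) = (\<Sum>S\<in>\<F>. \<Sum>(shift_within \<F> i j S))"
    unfolding total_def shift_family_def
    using inj_on_shift_within[of i j \<F>] assms(2) by (subst sum.reindex) auto
  have le: "\<Sum>(shift_within \<F> i j S) \<le> \<Sum>S" if "S \<in> \<F>" for S
    using sum_shift_less[OF finS[OF that] assms(2)] by (cases "shift i j S = S") (auto simp: shift_within_def)
  show "total (shift_family i j \<F>) \<le> total \<F>"
    unfolding eq unfolding total_def by (rule sum_mono) (rule le)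
  assume S: "S \<in> \<F>" "shift i j S \<notin> \<F>"
  then have "shift i j S \<noteq> S" by metis
  then have lt: "\<Sum>(shift_within \<F> i j S) < \<Sum>S"
    using sum_shift_less[OF finS[OF S(1)] assms(2)] S(2) by (simp add: shift_within_def)
  show "total (shift_family i j \<F>) < total \<F>"
    unfolding eq unfolding total_def
    by (rule sum_strict_mono_ex1[OF fin]) (use le lt S(1) in auto)
qed

lemma not_shiftedE:
  assumes "\<not> (shifted \<F> \<and> shifted \<G>)" "\<F> \<subseteq> supports m r" "\<G> \<subseteq> supports n s"
  obtains i j where "1 \<le> i" "i < j"
    "total (shift_family i j \<F>) + total (shift_family i j \<G>) < total \<F> + total \<G>"
proof -
  obtain i j where ij: "1 \<le> i" "i < j" and "(\<exists>S\<in>\<F>. shift i j S \<notin> \<F>) \<or> (\<exists>S\<in>\<G>. shift i j S \<notin> \<G>)"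
    using assms(1) unfolding shifted_def by blast
  then have "total (shift_family i j \<F>) + total (shift_family i j \<G>) < total \<F> + total \<G>"
    using total_shift_family[OF assms(2) ij(2)] total_shift_family[OF assms(3) ij(2)]
    by (meson add_le_less_mono add_less_le_mono)
  then show ?thesis using that ij by blast
qed

text \<open>A member of size \<open>t\<close> must be contained in every set of the other family. That family then lies in a star
and has the weight of this star, so it equals the star. It contains the small set as well, which gives the
same conclusion for the first family.\<close>

lemma stars_if_small_member:
  assumes "crossing l t \<F> \<G>" "\<F> \<subseteq> supports m r" "\<G> \<subseteq> supports n s"
    and S: "S \<in> \<F>" "card S = t" and t: "1 \<le> t" "t \<le> r" "t \<le> s"
    and F: "weight r \<F> = (m + r - t - 1) choose (r - t)"
    and G: "weight s \<G> = (n + s - t - 1) choose (s - t)" and "\<G> \<noteq> {}"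
  shows "S \<subseteq> {1..m} \<and> S \<subseteq> {1..n} \<and> \<F> = star m r S \<and> \<G> = star n s S"
proof -
  have "finite S" using S assms(2) supports_finite by blast
  have sub: "S \<subseteq> B" if "A \<in> \<F>" "card (A \<inter> B \<inter> {1..l}) \<ge> t" "A = S" for A B
  proof -
    have "A \<inter> B \<inter> {1..l} = A" using that S(2) \<open>finite S\<close> by (intro card_subset_eq) (auto intro: card_mono antisym)
    then show ?thesis using that by blast
  qed
  have GS: "\<G> \<subseteq> star n s S"
    using assms(1,3) S(1) sub unfolding crossing_def star_def by blast
  then have Sn: "S \<subseteq> {1..n}" using \<open>\<G> \<noteq> {}\<close> by (auto simp: star_def supports_def)
  have Sm: "S \<subseteq> {1..m}" using S(1) assms(2) by (auto simp: supports_def)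
  have ne: "S \<noteq> {}" using S(2) t(1) by auto
  have "weight s (star n s S) = weight s \<G>" using weight_star[OF Sn ne, of s] S(2) t G by simp
  then have GS: "\<G> = star n s S" by (intro weight_subset_eq[OF GS, of n s]) (auto simp: star_def)
  have "S \<in> \<G>" unfolding GS star_def supports_def using Sn ne S(2) t by simp
  then have "t \<le> card (A \<inter> S \<inter> {1..l})" if "A \<in> \<F>" for A
    using assms(1) that unfolding crossing_def by blast
  then have "S \<subseteq> A" if "A \<in> \<F>" for A using that sub[OF S(1), of A] by (simp add: Int_commute)
  then have FS: "\<F> \<subseteq> star m r S" using assms(2) unfolding star_def by blast
  have "weight r (star m r S) = weight r \<F>" using weight_star[OF Sm ne, of r] S(2) t F by simp
  then have "\<F> = star m r S" by (intro weight_subset_eq[OF FS, of m r]) (auto simp: star_def)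
  then show ?thesis using GS Sn Sm by blast
qed

section \<open>Exchanging sets in the family of traces\<close>

definition mass :: "(nat \<Rightarrow> real) \<Rightarrow> nat set set \<Rightarrow> real" where
  "mass g \<A> = (\<Sum>E\<in>\<A>. g (card E))"

text \<open>The sets of size \<open>i\<close> for which \<open>l\<close> cannot be dropped within the family. They are the ones that are moved
or discarded by an exchange.\<close>

definition layer :: "nat \<Rightarrow> nat set set \<Rightarrow> nat \<Rightarrow> nat set set" where
  "layer l \<A> i = {E \<in> \<A>. l \<in> E \<and> card E = i \<and> E - {l} \<notin> \<A>}"

lemma mass_layer: "mass g (layer l \<A> i) = real (card (layer l \<A> i)) * g i"
  by (simp add: mass_def layer_def)

lemma mass_minus_layer:
  assumes "finite \<A>"
  shows "mass g (\<A> - layer l \<A> i) = mass g \<A> - real (card (layer l \<A> i)) * g i"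
  unfolding mass_layer[symmetric] unfolding mass_def
  by (rule sum_diff) (use assms in \<open>auto simp: layer_def\<close>)

lemma mass_plus_lowered_layer:
  assumes "\<A> \<subseteq> Pow {1..l}"
  shows "mass g (\<A> \<union> (\<lambda>E. E - {l}) ` layer l \<A> i) = mass g \<A> + real (card (layer l \<A> i)) * g (i - 1)"
proof -
  let ?f = "\<lambda>E. E - {l}"
  have fin: "finite \<A>" using finite_subset[OF assms] by simp
  have finE: "finite E" if "E \<in> \<A>" for E using that assms finite_subset[of E "{1..l}"] by auto
  have inj: "inj_on ?f (layer l \<A> i)"
    by (rule inj_onI) (metis (mono_tags, lifting) insert_Diff layer_def mem_Collect_eq)
  have "mass g (\<A> \<union> ?f ` layer l \<A> i) = mass g \<A> + mass g (?f ` layer l \<A> i)"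
    unfolding mass_def by (rule sum.union_disjoint) (use fin in \<open>auto simp: layer_def\<close>)
  also have "mass g (?f ` layer l \<A> i) = (\<Sum>E\<in>layer l \<A> i. g (card (E - {l})))"
    unfolding mass_def by (simp add: sum.reindex[OF inj])
  also have "\<dots> = (\<Sum>E\<in>layer l \<A> i. g (i - 1))"
    by (rule sum.cong) (auto simp: layer_def finE)
  finally show ?thesis by simp
qed

lemma mass_mono:
  assumes "\<And>i. 0 \<le> g i" "\<B> \<subseteq> \<A>" "finite \<A>"
  shows "mass g \<B> \<le> mass g \<A>"
  unfolding mass_def by (rule sum_mono2) (use assms in auto)

text \<open>Replacing \<open>l\<close> in a set \<open>E\<close> of the layer by one of the \<open>l - i\<close> elements outside \<open>E\<close> yields a set of the
shifted family of the same size that avoids \<open>l\<close>, and each such set arises at most \<open>i\<close> times. So the layer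
carries at most the fraction \<open>i / l\<close> of the mass.\<close>

lemma layer_double_count:
  assumes sub: "\<A> \<subseteq> Pow {1..l}" and sh: "shifted \<A>" and "i \<le> l" and g: "\<And>i. 0 \<le> g i"
  shows "real l * mass g (layer l \<A> i) \<le> real i * mass g \<A>"
proof -
  define X where "X = layer l \<A> i"
  define Y where "Y = {E \<in> \<A>. card E = i \<and> l \<notin> E}"
  have fin: "finite \<A>" using finite_subset[OF sub] by simp
  then have finXY: "finite X" "finite Y" by (auto simp: X_def Y_def layer_def)
  have finE: "finite E" if "E \<in> \<A>" for E using that sub finite_subset[of E "{1..l}"] by auto
  have "card (SIGMA E:X. {1..l} - E) \<le> card (SIGMA E:Y. E)"
  proof (rule card_inj_on_le[where f = "\<lambda>(E, e). (insert e (E - {l}), e)"])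
    show "finite (SIGMA E:Y. E)" using finXY finE by (intro finite_SigmaI) (auto simp: Y_def)
    show "inj_on (\<lambda>(E, e). (insert e (E - {l}), e)) (SIGMA E:X. {1..l} - E)"
    proof (rule inj_onI)
      fix z z' assume zz: "z \<in> (SIGMA E:X. {1..l} - E)" "z' \<in> (SIGMA E:X. {1..l} - E)"
        and eq: "(\<lambda>(E, e). (insert e (E - {l}), e)) z = (\<lambda>(E, e). (insert e (E - {l}), e)) z'"
      obtain E e E' e' where z: "z = (E, e)" "z' = (E', e')" by fastforce
      then have "e' = e" using eq by simp
      have *: "E \<in> X" "E' \<in> X" "e \<notin> E" "e \<notin> E'" using zz z \<open>e' = e\<close> by auto
      then have "l \<in> E" "l \<in> E'" by (auto simp: X_def layer_def)
      moreover have "insert e (E - {l}) = insert e (E' - {l})" using eq z \<open>e' = e\<close> by simp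
      then have "E - {l} = E' - {l}" using *(3,4) by (metis Diff_iff insert_ident)
      ultimately have "E = E'" by (metis insert_Diff)
      then show "z = z'" using z \<open>e' = e\<close> by simp
    qed
    show "(\<lambda>(E, e). (insert e (E - {l}), e)) ` (SIGMA E:X. {1..l} - E) \<subseteq> (SIGMA E:Y. E)"
    proof (rule image_subsetI)
      fix z assume "z \<in> (SIGMA E:X. {1..l} - E)"
      then obtain E e where z: "z = (E, e)" and *: "E \<in> X" "e \<in> {1..l}" "e \<notin> E" by blast
      then have E: "E \<in> \<A>" "l \<in> E" "card E = i" by (auto simp: X_def layer_def)
      then have "e \<noteq> l" using * by blast
      then have "1 \<le> e" "e < l" using *(2) by auto
      then have "shift e l E \<in> \<A>" using sh E unfolding shifted_def by blast
      moreover have "shift e l E = insert e (E - {l})" using E * by (simp add: shift_def)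
      moreover have "card (shift e l E) = i" using card_shift[OF finE[OF E(1)]] E(3) by simp
      ultimately have "insert e (E - {l}) \<in> Y" unfolding Y_def using \<open>e \<noteq> l\<close> by simp
      then show "(\<lambda>(E, e). (insert e (E - {l}), e)) z \<in> (SIGMA E:Y. E)" unfolding z by simp
    qed
  qed
  moreover have "card (SIGMA E:X. {1..l} - E) = (\<Sum>E\<in>X. l - i)"
  proof (subst card_SigmaI[OF finXY(1)])
    show "(\<Sum>E\<in>X. card ({1..l} - E)) = (\<Sum>E\<in>X. l - i)"
    proof (rule sum.cong)
      fix E assume "E \<in> X"
      then have "E \<in> \<A>" "card E = i" by (auto simp: X_def layer_def)
      then show "card ({1..l} - E) = l - i" using sub finE by (subst card_Diff_subset) auto
    qed simp
  qed simp
  moreover have "card (SIGMA E:Y. E) = (\<Sum>E\<in>Y. i)"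
    using finXY finE by (subst card_SigmaI) (auto simp: Y_def)
  ultimately have "card X * (l - i) \<le> card Y * i" by simp
  then have "real (card X) * real (l - i) \<le> real (card Y) * real i" by (metis of_nat_le_iff of_nat_mult)
  then have XY: "real l * card X \<le> real i * (real (card X) + real (card Y))"
    using \<open>i \<le> l\<close> by (simp add: of_nat_diff algebra_simps)
  have "mass g X + mass g Y = mass g (X \<union> Y)"
    unfolding mass_def by (rule sum.union_disjoint[symmetric]) (use finXY in \<open>auto simp: X_def Y_def layer_def\<close>)
  also have "\<dots> \<le> mass g \<A>" by (rule mass_mono[OF g _ fin]) (auto simp: X_def Y_def layer_def)
  finally have le: "mass g X + mass g Y \<le> mass g \<A>" .
  have mY: "mass g Y = real (card Y) * g i" by (simp add: mass_def Y_def)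
  have mX: "mass g X = real (card X) * g i" unfolding X_def by (rule mass_layer)
  have "real l * mass g X = (real l * card X) * g i" by (simp add: mX)
  also have "\<dots> \<le> (real i * (real (card X) + real (card Y))) * g i"
    by (rule mult_right_mono[OF XY]) (rule g)
  also have "\<dots> = real i * (mass g X + mass g Y)" by (simp add: mX mY algebra_simps)
  also have "\<dots> \<le> real i * mass g \<A>" by (rule mult_left_mono[OF le]) simp
  finally show ?thesis unfolding X_def .
qed

text \<open>If neither of two opposite exchanges is profitable, the exchanged part \<open>p\<close> makes up nearly all of \<open>a\<close>. Here
\<open>p\<close> and \<open>q\<close> are the masses of the layers, and lowering a layer multiplies its mass by \<open>c\<close>.\<close>

lemma exchange_inequalities:
  fixes a b p q c :: real
  assumes "(a + c * p) * (b - q) \<le> a * b" "(a - p) * (b + c * q) \<le> a * b"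
    and "0 < p" "0 < q" "0 < c"
  shows "c * (a - p) \<le> a"
proof -
  have "c * (q * (a - p)) \<le> p * b" using assms(2) by (simp add: algebra_simps)
  then have "c * (c * (q * (a - p))) \<le> c * (p * b)" using assms(5) by (intro mult_left_mono) auto
  also have "\<dots> \<le> q * (a + c * p)" using assms(1) by (simp add: algebra_simps)
  finally have "q * (c * c * (a - p)) \<le> q * (a + c * p)" by (simp add: algebra_simps)
  then have "c * c * (a - p) \<le> a + c * p" using assms(4) by simp
  then have "(1 + c) * (c * (a - p)) \<le> (1 + c) * a" by (simp add: algebra_simps)
  then show ?thesis using assms(5) by simp
qed

text \<open>The families of traces on \<open>{1..l}\<close> of a shifted pair of maximum product, where \<open>l\<close> is least with
the crossing property; \<open>g\<close> and \<open>h\<close> are the weights of a trace of given size. The ratio condition is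
only required for sizes at which a critical pair can occur. All assumptions are symmetric in the two families,
so every result below also holds with their roles exchanged (lemma \<open>swap\<close>).\<close>

locale trace_pair =
  fixes l t :: nat and c :: real and g h :: "nat \<Rightarrow> real" and \<A> \<B> :: "nat set set"
  assumes t: "1 \<le> t" "t < l"
    and c: "real t \<le> c" "2 + 2 * real t / 3 < c"
    and sub: "\<A> \<subseteq> Pow {1..l}" "\<B> \<subseteq> Pow {1..l}"
    and sh: "shifted \<A>" "shifted \<B>"
    and cross: "crossing l t \<A> \<B>"
    and not_cross: "\<not> crossing (l - 1) t \<A> \<B>"
    and nonneg: "\<And>i. 0 \<le> g i" "\<And>i. 0 \<le> h i"
    and pos: "\<And>E. E \<in> \<A> \<Longrightarrow> 0 < g (card E)" "\<And>F. F \<in> \<B> \<Longrightarrow> 0 < h (card F)"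
    and ratio: "\<And>E F. \<lbrakk>E \<in> \<A>; F \<in> \<B>; card E + card F = l + t; t < card E\<rbrakk> \<Longrightarrow> c * g (card E) \<le> g (card E - 1)"
      "\<And>E F. \<lbrakk>E \<in> \<A>; F \<in> \<B>; card E + card F = l + t; t < card F\<rbrakk> \<Longrightarrow> c * h (card F) \<le> h (card F - 1)"
    and maximal: "\<And>\<A>' \<B>'. \<lbrakk>\<A>' \<subseteq> Pow {1..l}; \<B>' \<subseteq> Pow {1..l}; crossing l t \<A>' \<B>'\<rbrakk>
      \<Longrightarrow> mass g \<A>' * mass h \<B>' \<le> mass g \<A> * mass h \<B>"
begin

lemma swap: "trace_pair l t c h g \<B> \<A>"
proof
  show "crossing l t \<B> \<A>" using crossing_sym cross .
  show "\<not> crossing (l - 1) t \<B> \<A>" using not_cross crossing_sym by blast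
  show "c * h (card E) \<le> h (card E - 1)"
    if "E \<in> \<B>" "F \<in> \<A>" "card E + card F = l + t" "t < card E" for E F
    using ratio(2)[OF that(2,1) _ that(4)] that(3) by simp
  show "c * g (card F) \<le> g (card F - 1)"
    if "E \<in> \<B>" "F \<in> \<A>" "card E + card F = l + t" "t < card F" for E F
    using ratio(1)[OF that(2,1) _ that(4)] that(3) by simp
  show "mass h \<A>' * mass g \<B>' \<le> mass h \<B> * mass g \<A>"
    if "\<A>' \<subseteq> Pow {1..l}" "\<B>' \<subseteq> Pow {1..l}" "crossing l t \<A>' \<B>'" for \<A>' \<B>'
    using maximal[OF that(2,1) crossing_sym[OF that(3)]] by (simp add: mult.commute)
qed (use t c sub sh nonneg pos in auto)

definition critical :: "nat set \<Rightarrow> nat set \<Rightarrow> bool" where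
  "critical E F \<longleftrightarrow> E \<in> \<A> \<and> F \<in> \<B> \<and> card (E \<inter> F \<inter> {1..l - 1}) < t"

lemma ex_critical: "\<exists>E F. critical E F"
  using not_cross unfolding crossing_def critical_def by (meson not_le)

lemma fin: "finite \<A>" "finite \<B>"
  using finite_subset[OF sub(1)] finite_subset[OF sub(2)] by auto

lemma finE: "E \<in> \<A> \<Longrightarrow> finite E" "E \<in> \<B> \<Longrightarrow> finite E"
  using sub finite_subset[of E "{1..l}"] by auto

lemma meet: "E \<in> \<A> \<Longrightarrow> F \<in> \<B> \<Longrightarrow> t \<le> card (E \<inter> F)"
proof -
  assume "E \<in> \<A>" "F \<in> \<B>"
  then have "E \<inter> F \<inter> {1..l} = E \<inter> F" "t \<le> card (E \<inter> F \<inter> {1..l})"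
    using sub(1) cross unfolding crossing_def by blast+
  then show ?thesis by simp
qed

text \<open>If an element \<open>e\<close> were outside \<open>E \<union> F\<close>, then shifting \<open>l\<close> to \<open>e\<close> in \<open>E\<close> would destroy one of the \<open>t\<close> common elements
without creating a new one. So \<open>E\<close> and \<open>F\<close> cover \<open>{1..l}\<close>, which determines the sum of their sizes.\<close>

lemma critical_pair:
  assumes "critical E F"
  shows "l \<in> E" "l \<in> F" "card E + card F = l + t" "E \<in> layer l \<A> (card E)" "F \<in> layer l \<B> (card F)"
proof -
  have EF: "E \<in> \<A>" "F \<in> \<B>" and lt: "card (E \<inter> F \<inter> {1..l - 1}) < t"
    using assms by (auto simp: critical_def)
  have subEF: "E \<subseteq> {1..l}" "F \<subseteq> {1..l}" using EF sub by auto
  have eq: "E \<inter> F \<inter> {1..l - 1} = E \<inter> F - {l}"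
  proof -
    have "{1..l - 1} = {1..l} - {l}" using t by auto
    then show ?thesis using subEF by blast
  qed
  have lEF: "l \<in> E \<inter> F"
  proof (rule ccontr)
    assume "l \<notin> E \<inter> F"
    then have "E \<inter> F - {l} = E \<inter> F" by blast
    then show False using meet[OF EF] lt eq by simp
  qed
  then show l: "l \<in> E" "l \<in> F" by auto
  have "Suc (card (E \<inter> F - {l})) = card (E \<inter> F)"
    using lEF finE(1)[OF EF(1)] by (intro card_Suc_Diff1) auto
  then have tt: "card (E \<inter> F) = t" using meet[OF EF] lt eq by simp
  have un: "E \<union> F = {1..l}"
  proof (rule ccontr)
    assume "E \<union> F \<noteq> {1..l}"
    then obtain e where e: "1 \<le> e" "e \<le> l" "e \<notin> E" "e \<notin> F" using subEF by fastforce
    then have "e < l" using l(1) by (cases "e = l") auto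
    then have "shift e l E \<in> \<A>" using sh(1) EF(1) e(1) unfolding shifted_def by blast
    moreover have "shift e l E \<inter> F = E \<inter> F - {l}" using e(3,4) l by (auto simp: shift_def)
    ultimately show False using meet[OF _ EF(2)] lt eq by fastforce
  qed
  show "card E + card F = l + t"
    using card_Un_Int[OF finE(1)[OF EF(1)] finE(2)[OF EF(2)]] un tt by simp
  have "E - {l} \<notin> \<A>"
  proof
    assume "E - {l} \<in> \<A>"
    then have "t \<le> card ((E - {l}) \<inter> F)" using meet EF(2) by blast
    moreover have "(E - {l}) \<inter> F = E \<inter> F - {l}" by blast
    ultimately show False using lt eq by simp
  qed
  then show "E \<in> layer l \<A> (card E)" using EF l by (simp add: layer_def)
  have "F - {l} \<notin> \<B>"
  proof
    assume "F - {l} \<in> \<B>"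
    then have "t \<le> card (E \<inter> (F - {l}))" using meet EF(1) by blast
    moreover have "E \<inter> (F - {l}) = E \<inter> F - {l}" by blast
    ultimately show False using lt eq by simp
  qed
  then show "F \<in> layer l \<B> (card F)" using EF l by (simp add: layer_def)
qed

lemma critical_card:
  assumes "critical E F"
  shows "t \<le> card E" "card E \<le> l"
proof -
  have EF: "E \<in> \<A>" "F \<in> \<B>" using assms by (auto simp: critical_def)
  show "t \<le> card E"
    using meet[OF EF] card_mono[OF finE(1)[OF EF(1)], of "E \<inter> F"] by simp
  show "card E \<le> l" using sub(1) EF(1) card_mono[of "{1..l}" E] by auto
qed

lemma mass_pos: "0 < mass g \<A>"
proof -
  have "\<A> \<noteq> {}" using ex_critical by (auto simp: critical_def)
  then show ?thesis unfolding mass_def using fin pos by (intro sum_pos) auto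
qed

text \<open>Dropping \<open>l\<close> from \<open>E\<close> only harms the partners \<open>F\<close> that are critical for \<open>E\<close>, and all of these lie in the discarded layer.\<close>

lemma crossing_exchange:
  assumes "i + j = l + t"
  shows "crossing l t (\<A> \<union> (\<lambda>E. E - {l}) ` layer l \<A> i) (\<B> - layer l \<B> j)"
  unfolding crossing_def
proof (intro ballI)
  fix E F assume E: "E \<in> \<A> \<union> (\<lambda>E. E - {l}) ` layer l \<A> i" and F: "F \<in> \<B> - layer l \<B> j"
  from E show "t \<le> card (E \<inter> F \<inter> {1..l})"
  proof
    assume "E \<in> \<A>" then show ?thesis using cross F unfolding crossing_def by blast
  next
    assume "E \<in> (\<lambda>E. E - {l}) ` layer l \<A> i"
    then obtain E0 where E0: "E = E0 - {l}" "E0 \<in> \<A>" "card E0 = i" by (auto simp: layer_def)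
    have "E \<inter> F \<inter> {1..l} = E0 \<inter> F \<inter> {1..l - 1}"
      unfolding E0(1) using t by auto
    moreover have "\<not> critical E0 F"
    proof
      assume cr: "critical E0 F"
      then have "card F = j" using critical_pair(3)[OF cr] assms E0(3) by simp
      then show False using critical_pair(5)[OF cr] F by simp
    qed
    ultimately show ?thesis using E0(2) F unfolding critical_def by auto
  qed
qed

lemma exchange_bound:
  assumes cr: "critical E F" and "t < card E"
  shows "(mass g \<A> + c * mass g (layer l \<A> (card E))) * (mass h \<B> - mass h (layer l \<B> (card F)))
    \<le> mass g \<A> * mass h \<B>"
proof -
  let ?\<A> = "\<A> \<union> (\<lambda>E. E - {l}) ` layer l \<A> (card E)" and ?\<B> = "\<B> - layer l \<B> (card F)"
  have EF: "E \<in> \<A>" "F \<in> \<B>" using cr by (auto simp: critical_def)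
  have "c * mass g (layer l \<A> (card E)) = real (card (layer l \<A> (card E))) * (c * g (card E))"
    by (simp add: mass_layer)
  also have "\<dots> \<le> real (card (layer l \<A> (card E))) * g (card E - 1)"
    by (intro mult_left_mono ratio(1)[OF EF critical_pair(3)[OF cr] assms(2)]) simp
  finally have A: "mass g \<A> + c * mass g (layer l \<A> (card E)) \<le> mass g ?\<A>"
    unfolding mass_plus_lowered_layer[OF sub(1)] by simp
  have B: "mass h \<B> - mass h (layer l \<B> (card F)) = mass h ?\<B>"
    unfolding mass_minus_layer[OF fin(2)] mass_layer ..
  have "(mass g \<A> + c * mass g (layer l \<A> (card E))) * (mass h \<B> - mass h (layer l \<B> (card F)))
    \<le> mass g ?\<A> * mass h ?\<B>"
    unfolding B by (intro mult_right_mono A) (auto simp: mass_def intro!: sum_nonneg nonneg)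
  also have "\<dots> \<le> mass g \<A> * mass h \<B>"
  proof (rule maximal)
    show "?\<A> \<subseteq> Pow {1..l}" using sub(1) by (auto simp: layer_def)
    show "?\<B> \<subseteq> Pow {1..l}" using sub(2) by auto
    show "crossing l t ?\<A> ?\<B>" by (rule crossing_exchange[OF critical_pair(3)[OF cr]])
  qed
  finally show ?thesis .
qed

lemma layer_mass_pos: "critical E F \<Longrightarrow> 0 < mass g (layer l \<A> (card E))"
proof -
  assume cr: "critical E F"
  then have "0 < g (card E)" "layer l \<A> (card E) \<noteq> {}" "finite (layer l \<A> (card E))"
    using pos(1) critical_pair(4)[OF cr] fin(1) by (auto simp: critical_def layer_def)
  then show ?thesis unfolding mass_layer by (simp add: card_gt_0_iff)
qed

lemma critical_swap: "critical E F \<longleftrightarrow> trace_pair.critical l t \<B> \<A> F E"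
proof -
  interpret sw: trace_pair l t c h g \<B> \<A> by (rule swap)
  show ?thesis unfolding critical_def sw.critical_def by (auto simp: Int_commute)
qed

text \<open>Since both sizes exceed \<open>t\<close>, either side may be lowered at the expense of the other, and by maximality
neither exchange is profitable. So all but a fraction \<open>1 / c\<close> of the mass lies in the layer.\<close>

lemma layer_large:
  assumes cr: "critical E F" and "t < card E" "t < card F"
  shows "c * (mass g \<A> - mass g (layer l \<A> (card E))) \<le> mass g \<A>"
proof -
  interpret sw: trace_pair l t c h g \<B> \<A> by (rule swap)
  have sw: "sw.critical F E" using cr critical_swap by blast
  show ?thesis
  proof (rule exchange_inequalities)
    show "(mass g \<A> + c * mass g (layer l \<A> (card E))) * (mass h \<B> - mass h (layer l \<B> (card F)))
      \<le> mass g \<A> * mass h \<B>" by (rule exchange_bound[OF cr assms(2)])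
    show "(mass g \<A> - mass g (layer l \<A> (card E))) * (mass h \<B> + c * mass h (layer l \<B> (card F)))
      \<le> mass g \<A> * mass h \<B>" using sw.exchange_bound[OF sw assms(3)] by (simp add: mult.commute)
    show "0 < mass g (layer l \<A> (card E))" "0 < mass h (layer l \<B> (card F))"
      by (rule layer_mass_pos[OF cr] sw.layer_mass_pos[OF sw])+
    show "0 < c" using t c by simp
  qed
qed

text \<open>The lower bound on the mass of the layer is confronted with the upper bound \<open>card E / l\<close> of its share.\<close>

lemma critical_card_bound:
  assumes cr: "critical E F" and "t < card E" "t < card F"
  shows "c * (real l - real (card E)) \<le> real l"
proof -
  define a p where "a = mass g \<A>" and "p = mass g (layer l \<A> (card E))"
  have "real l * p \<le> real (card E) * a"
    unfolding p_def a_def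
    by (rule layer_double_count[OF sub(1) sh(1) critical_card(2)[OF cr] nonneg(1)])
  then have "(real l - real (card E)) * a \<le> real l * (a - p)" by (simp add: algebra_simps)
  then have "c * ((real l - real (card E)) * a) \<le> c * (real l * (a - p))"
    using t c by (intro mult_left_mono) auto
  also have "\<dots> = real l * (c * (a - p))" by simp
  also have "\<dots> \<le> real l * a"
    using layer_large[OF assms] unfolding a_def p_def by (intro mult_left_mono) auto
  finally have "(c * (real l - real (card E))) * a \<le> real l * a" by (simp add: mult.assoc)
  then show ?thesis using mass_pos by (simp add: a_def)
qed

text \<open>The exchanged pair crosses below \<open>l\<close>, so it contradicts the minimality of \<open>l\<close> even if
its product is only as large as before. The strict version is what characterises equality.\<close>

definition improvable :: bool where
  "improvable \<longleftrightarrow> (\<exists>\<A>' \<B>'. \<A>' \<subseteq> Pow {1..l} \<and> \<B>' \<subseteq> Pow {1..l} \<and> crossing (l - 1) t \<A>' \<B>'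
    \<and> mass g \<A> * mass h \<B> \<le> mass g \<A>' * mass h \<B>'
    \<and> (real t < c \<longrightarrow> mass g \<A> * mass h \<B> < mass g \<A>' * mass h \<B>'))"

lemma improvable_swap: "improvable \<longleftrightarrow> trace_pair.improvable l t c h g \<B> \<A>"
proof -
  interpret sw: trace_pair l t c h g \<B> \<A> by (rule swap)
  show ?thesis unfolding improvable_def sw.improvable_def
    by (subst ex_comm) (metis crossing_sym mult.commute)
qed

text \<open>A trace \<open>E\<close> of size \<open>t\<close> and all its shifts are contained in every \<open>F\<close>, which forces \<open>\<B> = {{1..l}}\<close>. Discarding the
traces of size \<open>t\<close> that contain \<open>l\<close> costs at most the fraction \<open>t / l\<close> of the mass of \<open>\<A>\<close>, and then \<open>{1..l - 1}\<close> may be added to \<open>\<B>\<close>, which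
multiplies its mass by at least \<open>1 + c\<close>.\<close>

lemma improvable_if_critical_minimal:
  assumes cr: "critical E F" and "card E = t"
  shows improvable
proof -
  have EF: "E \<in> \<A>" "F \<in> \<B>" using cr by (auto simp: critical_def)
  have contains: "E' \<subseteq> F'" if "E' \<in> \<A>" "card E' = t" "F' \<in> \<B>" for E' F'
  proof -
    have "E' \<inter> F' = E'"
      using meet[OF that(1,3)] that(2) finE(1)[OF that(1)] by (intro card_seteq) auto
    then show ?thesis by blast
  qed
  have full: "F' = {1..l}" if F': "F' \<in> \<B>" for F'
  proof
    show "F' \<subseteq> {1..l}" using sub(2) F' by blast
    show "{1..l} \<subseteq> F'"
    proof
      fix e assume e: "e \<in> {1..l}"
      show "e \<in> F'"
      proof (cases "e \<in> E")
        case True then show ?thesis using contains[OF EF(1) assms(2) F'] by blast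
      next
        case False
        then have "e \<noteq> l" using critical_pair(1)[OF cr] by blast
        then have "1 \<le> e" "e < l" using e by auto
        then have "shift e l E \<in> \<A>" using sh(1) EF(1) unfolding shifted_def by blast
        moreover have "card (shift e l E) = t" using card_shift[OF finE(1)[OF EF(1)]] assms(2) by simp
        ultimately have "shift e l E \<subseteq> F'" using contains F' by blast
        moreover have "e \<in> shift e l E" using False critical_pair(1)[OF cr] by (simp add: shift_def)
        ultimately show ?thesis by blast
      qed
    qed
  qed
  then have B: "\<B> = {{1..l}}" using EF(2) by blast
  have F: "F = {1..l}" using full EF(2) by blast
  let ?\<A> = "\<A> - layer l \<A> t" and ?\<B> = "{{1..l}, {1..l - 1}}"
  define a p where "a = mass g \<A>" and "p = mass g (layer l \<A> t)"
  have "\<not> critical E' {1..l}" if "E' \<in> ?\<A>" for E'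
  proof
    assume cr': "critical E' {1..l}"
    have "card E' = t" using critical_pair(3)[OF cr'] by simp
    then show False using critical_pair(4)[OF cr'] that by simp
  qed
  then have ge: "t \<le> card (E' \<inter> {1..l} \<inter> {1..l - 1})" if "E' \<in> ?\<A>" for E'
    using that B unfolding critical_def by (metis Diff_iff not_le singletonI)
  have sube: "{1..l} \<inter> {1..l - 1} = {1..l - 1} \<inter> {1..l - 1}" by auto
  have "crossing (l - 1) t ?\<A> ?\<B>"
    unfolding crossing_def
  proof (intro ballI)
    fix E' F' assume E': "E' \<in> ?\<A>" and "F' \<in> ?\<B>"
    then have "F' \<inter> {1..l - 1} = {1..l} \<inter> {1..l - 1}" using sube by auto
    then have "E' \<inter> F' \<inter> {1..l - 1} = E' \<inter> {1..l} \<inter> {1..l - 1}" by (simp only: Int_assoc)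
    then show "t \<le> card (E' \<inter> F' \<inter> {1..l - 1})" using ge[OF E'] by simp
  qed
  moreover have "?\<A> \<subseteq> Pow {1..l}" "?\<B> \<subseteq> Pow {1..l}" using sub(1) by auto
  moreover have "a * mass h \<B> \<le> mass g ?\<A> * mass h ?\<B> \<and> (real t < c \<longrightarrow> a * mass h \<B> < mass g ?\<A> * mass h ?\<B>)"
  proof -
    have h0: "0 < h l" using pos(2)[OF EF(2)] F by simp
    have mB: "mass h \<B> = h l" unfolding B by (simp add: mass_def)
    have "{1..l} \<noteq> {1..l - 1}" using t by auto
    then have "mass h ?\<B> = h l + h (l - 1)" by (simp add: mass_def)
    moreover have "c * h l \<le> h (l - 1)"
      using ratio(2)[OF EF critical_pair(3)[OF cr]] F t by simp
    ultimately have mB': "(1 + c) * h l \<le> mass h ?\<B>" by (simp add: algebra_simps)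
    have mA': "mass g ?\<A> = a - p" unfolding a_def p_def mass_layer by (rule mass_minus_layer[OF fin(1)])
    have a0: "0 < a" using mass_pos by (simp add: a_def)
    have lp: "real l * p \<le> real t * a"
      unfolding p_def a_def using t by (intro layer_double_count sub sh nonneg) auto
    have "(real l - real t) * a * (1 + c) \<le> real l * (a - p) * (1 + c)"
      using lp t c by (intro mult_right_mono) (auto simp: algebra_simps)
    moreover have "real l * a + (c - real t) * a \<le> (real l - real t) * a * (1 + c)"
    proof -
      have "1 * c \<le> (real l - real t) * c" using t c by (intro mult_right_mono) auto
      then have "(real l + (c - real t)) * a \<le> ((real l - real t) * (1 + c)) * a"
        using a0 by (intro mult_right_mono) (auto simp: algebra_simps)
      then show ?thesis by (simp add: algebra_simps)
    qed
    ultimately have main: "real l * a + (c - real t) * a \<le> real l * ((a - p) * (1 + c))" by (simp add: mult.assoc)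
    have "real l * a \<le> real l * ((a - p) * (1 + c))"
      using main c a0 mult_nonneg_nonneg[of "c - real t" a] by linarith
    then have le: "a \<le> (a - p) * (1 + c)" using t by simp
    have lt: "a < (a - p) * (1 + c)" if "real t < c"
    proof -
      have "real l * a < real l * ((a - p) * (1 + c))"
        using main that a0 mult_pos_pos[of "c - real t" a] by linarith
      then show ?thesis using t by simp
    qed
    have "0 \<le> mass g ?\<A>" unfolding mass_def by (intro sum_nonneg nonneg)
    then have "(a - p) * ((1 + c) * h l) \<le> mass g ?\<A> * mass h ?\<B>"
      unfolding mA' by (intro mult_left_mono mB')
    then have ge: "(a - p) * (1 + c) * h l \<le> mass g ?\<A> * mass h ?\<B>" by (simp add: mult.assoc)
    have "a * h l \<le> (a - p) * (1 + c) * h l" using h0 by (intro mult_right_mono le) simp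
    moreover have "a * h l < (a - p) * (1 + c) * h l" if "real t < c"
      by (rule mult_strict_right_mono[OF lt[OF that] h0])
    ultimately show ?thesis using ge unfolding mB by (meson order_trans less_le_trans)
  qed
  ultimately show ?thesis unfolding improvable_def a_def by blast
qed

text \<open>Here the sets of the layer are complements in \<open>{1..l}\<close> of single elements of \<open>{1..t + 1}\<close>, and by shifting, the complement of \<open>t + 1\<close>
lies in \<open>\<A>\<close>. If it were not in the layer, then \<open>{1..t}\<close> would lie in \<open>\<A>\<close>, and it alone would weigh at least as much
as the at most \<open>t\<close> sets of the layer, which contradicts that the layer makes up more than half of the mass.\<close>

lemma middle_layer:
  assumes l: "l = t + 2" and cr: "critical E F" and card: "card E = t + 1" "card F = t + 1"
  shows "insert l {1..t} \<in> layer l \<A> (t + 1)"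
    and "card (layer l \<A> (t + 1)) \<le> t + 1"
proof -
  have form: "\<exists>e\<in>{1..t + 1}. X = {1..l} - {e}" if X: "X \<in> layer l \<A> (t + 1)" for X
  proof -
    have X': "X \<subseteq> {1..l}" "card X = t + 1" "l \<in> X" using X sub(1) by (auto simp: layer_def)
    have "card ({1..l} - X) = 1"
      using X' l finite_subset[OF X'(1)] by (subst card_Diff_subset) auto
    then obtain e where e: "{1..l} - X = {e}" by (auto simp: card_1_singleton_iff)
    then have "X = {1..l} - {e}" using X'(1) by blast
    moreover have "e \<in> {1..l}" "e \<noteq> l" using e X'(3) by blast+
    then have "e \<in> {1..t + 1}" using l by auto
    ultimately show ?thesis by blast
  qed
  have top: "insert l {1..t} = {1..l} - {t + 1}" using l by auto
  have lay: "E \<in> layer l \<A> (t + 1)" using critical_pair(4)[OF cr] card by simp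
  then obtain e where e: "e \<in> {1..t + 1}" "E = {1..l} - {e}" using form by blast
  have EA: "E \<in> \<A>" using cr by (simp add: critical_def)
  have topA: "insert l {1..t} \<in> \<A>"
  proof (cases "e = t + 1")
    case True then show ?thesis using EA e top by simp
  next
    case False
    then have "1 \<le> e" "e < t + 1" using e by auto
    then have "shift e (t + 1) E \<in> \<A>" using sh(1) EA unfolding shifted_def by blast
    moreover have "shift e (t + 1) E = insert l {1..t}"
      unfolding top e(2) shift_def using e(1) False l by auto
    ultimately show ?thesis by simp
  qed
  have inj: "layer l \<A> (t + 1) \<subseteq> (\<lambda>e. {1..l} - {e}) ` {1..t + 1}" using form by blast
  show "card (layer l \<A> (t + 1)) \<le> t + 1"
    using card_mono[OF _ inj] card_image_le[of "{1..t + 1}" "\<lambda>e. {1..l} - {e}"] by simp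
  show "insert l {1..t} \<in> layer l \<A> (t + 1)"
  proof (rule ccontr)
    assume no: "insert l {1..t} \<notin> layer l \<A> (t + 1)"
    have lnot: "l \<notin> {1..t}" using l by simp
    then have low: "{1..t} \<in> \<A>" using no topA by (simp add: layer_def)
    have inj: "layer l \<A> (t + 1) \<subseteq> (\<lambda>e. {1..l} - {e}) ` {1..t}"
    proof
      fix X assume X: "X \<in> layer l \<A> (t + 1)"
      then obtain e where "e \<in> {1..t + 1}" "X = {1..l} - {e}" using form by blast
      moreover have "e \<noteq> t + 1" using X no top calculation(2) by metis
      ultimately show "X \<in> (\<lambda>e. {1..l} - {e}) ` {1..t}" by (intro image_eqI[of _ _ e]) auto
    qed
    have "card (layer l \<A> (t + 1)) \<le> t"
      using card_mono[OF _ inj] card_image_le[of "{1..t}" "\<lambda>e. {1..l} - {e}"] by simp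
    then have "real (card (layer l \<A> (t + 1))) \<le> c" using c by linarith
    define a p where "a = mass g \<A>" and "p = mass g (layer l \<A> (t + 1))"
    have "p \<le> c * g (t + 1)"
      unfolding p_def mass_layer by (intro mult_right_mono nonneg) fact
    also have "\<dots> \<le> g t"
      using ratio(1)[of E F] cr critical_pair(3)[OF cr] card by (simp add: critical_def)
    finally have "p \<le> g t" .
    have "p + g t = mass g (insert {1..t} (layer l \<A> (t + 1)))"
      unfolding p_def mass_def using fin(1) lnot
      by (subst sum.insert) (auto simp: layer_def)
    also have "\<dots> \<le> a" unfolding a_def
      by (rule mass_mono[OF nonneg(1) _ fin(1)]) (use low in \<open>auto simp: layer_def\<close>)
    finally have "p + g t \<le> a" .
    with \<open>p \<le> g t\<close> have "a \<le> 2 * (a - p)" by (simp add: algebra_simps)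
    moreover have "c * (a - p) \<le> a" using layer_large[OF cr] card unfolding a_def p_def by simp
    moreover have "2 < c" using c t by simp
    moreover have "0 < a" using mass_pos unfolding a_def .
    moreover have "0 < a - p" using \<open>a \<le> 2 * (a - p)\<close> \<open>0 < a\<close>
      by (metis less_le_trans zero_less_mult_pos zero_less_numeral)
    then have "2 * (a - p) < c * (a - p)" by (rule mult_strict_right_mono[OF \<open>2 < c\<close>])
    ultimately show False by (meson leD less_le_trans order_trans)
  qed
qed

text \<open>At most \<open>t\<close> sets are discarded, and the new set \<open>{1..t}\<close> weighs at least \<open>c \<ge> t\<close> times as much as each of them.\<close>

lemma mass_middle_exchange:
  assumes l: "l = t + 2" and cr: "critical E F" and card: "card E = t + 1" "card F = t + 1"
  shows "mass g \<A> + (c - real t) * g (t + 1)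
    \<le> mass g (insert {1..t} (insert (insert l {1..t}) (\<A> - layer l \<A> (t + 1))))"
    and "0 < g (t + 1)"
proof -
  let ?X = "insert l {1..t}" and ?L = "layer l \<A> (t + 1)"
  have X: "?X \<in> ?L" and cL: "card ?L \<le> t + 1" using middle_layer[OF assms] by auto
  have lnot: "l \<notin> {1..t}" using l by simp
  have cX: "card ?X = t + 1" using lnot by simp
  have tA: "{1..t} \<notin> \<A>" using X lnot by (simp add: layer_def)
  have "{1..t} \<noteq> ?X" using lnot by blast
  then have "mass g (insert {1..t} (insert ?X (\<A> - ?L))) = g t + (g (t + 1) + mass g (\<A> - ?L))"
    unfolding mass_def using fin(1) tA X cX by (simp add: sum.insert)
  also have "\<dots> = g t + g (t + 1) + mass g \<A> - real (card ?L) * g (t + 1)"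
    unfolding mass_minus_layer[OF fin(1)] by simp
  finally have eq: "mass g (insert {1..t} (insert ?X (\<A> - ?L)))
    = g t + g (t + 1) + mass g \<A> - real (card ?L) * g (t + 1)" .
  have "real (card ?L) * g (t + 1) \<le> (real t + 1) * g (t + 1)"
    using cL by (intro mult_right_mono nonneg) linarith
  moreover have "c * g (t + 1) \<le> g t"
    using ratio(1)[of E F] cr critical_pair(3)[OF cr] card by (simp add: critical_def)
  ultimately show "mass g \<A> + (c - real t) * g (t + 1) \<le> mass g (insert {1..t} (insert ?X (\<A> - ?L)))"
    unfolding eq by (simp add: algebra_simps)
  show "0 < g (t + 1)" using pos(1)[of E] cr card by (simp add: critical_def)
qed

lemma improvable: improvable
proof -
  interpret sw: trace_pair l t c h g \<B> \<A> by (rule swap)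
  consider (minA) E F where "critical E F" "card E = t" | (minB) E F where "critical E F" "card F = t"
    | (middle) "\<And>E F. critical E F \<Longrightarrow> card E \<noteq> t \<and> card F \<noteq> t" by blast
  then show ?thesis
  proof cases
    case minA then show ?thesis by (rule improvable_if_critical_minimal)
  next
    case minB
    then have "sw.improvable" using sw.improvable_if_critical_minimal critical_swap by blast
    then show ?thesis using improvable_swap by blast
  next
    case middle
    have gt: "t < card E" "t < card F" if "critical E F" for E F
      using middle[OF that] critical_card(1)[OF that] sw.critical_card(1)[of F E] that critical_swap
      by (metis le_neq_implies_less)+
    obtain E F where cr: "critical E F" using ex_critical by blast
    have sum: "card E + card F = l + t" by (rule critical_pair(3)[OF cr])
    have l: "l = t + 2"
    proof (rule ccontr)
      assume "l \<noteq> t + 2"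
      then have d: "t + 3 \<le> l" using sum gt[OF cr] critical_card(2)[OF cr] sw.critical_card(2)[of F E] cr critical_swap
        by force
      have "c * (real l - real (card E)) + c * (real l - real (card F)) \<le> 2 * real l"
        using critical_card_bound[OF cr gt[OF cr]]
          sw.critical_card_bound[of F E] gt[OF cr] cr critical_swap by force
      moreover have "real (card E) + real (card F) = real l + real t" using sum by linarith
      ultimately have "c * (real l - real t) \<le> 2 * real l"
        by (metis (no_types, opaque_lifting) add_diff_add add_diff_cancel_left distrib_left)
      \<comment> \<open>With \<open>l - t \<ge> 3\<close> this reads \<open>c \<le> 2 + 2 * t / 3\<close>.\<close>
      then have "(c - 2) * (real l - real t) \<le> 2 * real t" by (simp add: algebra_simps)
      moreover have "(c - 2) * 3 \<le> (c - 2) * (real l - real t)"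
        using d c by (intro mult_left_mono) auto
      ultimately show False using c by simp
    qed
    have cards: "card E = t + 1 \<and> card F = t + 1" if "critical E F" for E F
      using gt[OF that] critical_pair(3)[OF that] l by linarith
    have cr': "sw.critical F E" using cr critical_swap by blast
    let ?X = "insert l {1..t}"
    let ?\<A> = "insert {1..t} (insert ?X (\<A> - layer l \<A> (t + 1)))"
    let ?\<B> = "insert {1..t} (insert ?X (\<B> - layer l \<B> (t + 1)))"
    have XA: "?X \<in> \<A>" using middle_layer(1)[OF l cr] cards[OF cr] by (simp add: layer_def)
    have XB: "?X \<in> \<B>" using sw.middle_layer(1)[OF l cr'] cards[OF cr] by (simp add: layer_def)
    have XX: "{1..t} \<inter> {1..l - 1} = ?X \<inter> {1..l - 1}" using l by auto
    \<comment> \<open>Below \<open>l\<close>, the new set \<open>{1..t}\<close> looks like \<open>?X\<close>, so the crossing property need only be checked for old sets.\<close>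
    have trace: "\<exists>E'\<in>insert ?X (\<C> - layer l \<C> (t + 1)). E \<inter> {1..l - 1} = E' \<inter> {1..l - 1}"
      if "E \<in> insert {1..t} (insert ?X (\<C> - layer l \<C> (t + 1)))" for E \<C>
      using that XX by blast
    have "crossing (l - 1) t ?\<A> ?\<B>"
      unfolding crossing_def
    proof (intro ballI)
      fix E F assume "E \<in> ?\<A>" "F \<in> ?\<B>"
      then obtain E' F' where E': "E' \<in> insert ?X (\<A> - layer l \<A> (t + 1))" "E \<inter> {1..l - 1} = E' \<inter> {1..l - 1}"
        and F': "F' \<in> insert ?X (\<B> - layer l \<B> (t + 1))" "F \<inter> {1..l - 1} = F' \<inter> {1..l - 1}"
        using trace by meson
      have "E \<inter> F \<inter> {1..l - 1} = E' \<inter> F' \<inter> {1..l - 1}" using E'(2) F'(2) by blast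
      moreover have "\<not> critical E' F'"
      proof
        assume cr: "critical E' F'"
        have "E' \<in> layer l \<A> (t + 1)" "F' \<in> layer l \<B> (t + 1)"
          using critical_pair(4,5)[OF cr] cards[OF cr] by auto
        then have "E' = ?X" "F' = ?X" using E'(1) F'(1) by auto
        then have "card (?X \<inter> {1..l - 1}) < t" using cr by (simp add: critical_def)
        moreover have "?X \<inter> {1..l - 1} = {1..t}" using l by auto
        ultimately show False by simp
      qed
      ultimately show "t \<le> card (E \<inter> F \<inter> {1..l - 1})"
        using E'(1) F'(1) XA XB unfolding critical_def by (metis Diff_iff insertE not_le)
    qed
    moreover have "?\<A> \<subseteq> Pow {1..l}" "?\<B> \<subseteq> Pow {1..l}"
      using sub XA XB l by auto
    moreover have "mass g \<A> * mass h \<B> \<le> mass g ?\<A> * mass h ?\<B> \<and>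
      (real t < c \<longrightarrow> mass g \<A> * mass h \<B> < mass g ?\<A> * mass h ?\<B>)"
    proof -
      define x y where "x = (c - real t) * g (t + 1)" and "y = (c - real t) * h (t + 1)"
      have A: "mass g \<A> + x \<le> mass g ?\<A>" and g0: "0 < g (t + 1)"
        using mass_middle_exchange[OF l cr] cards[OF cr] unfolding x_def by auto
      have B: "mass h \<B> + y \<le> mass h ?\<B>" and h0: "0 < h (t + 1)"
        using sw.mass_middle_exchange[OF l cr'] cards[OF cr] unfolding y_def by auto
      have x0: "0 \<le> x" "0 \<le> y" and x1: "real t < c \<longrightarrow> 0 < x \<and> 0 < y"
        using c g0 h0 unfolding x_def y_def by auto
      show ?thesis
        using A B x0 x1 mass_pos sw.mass_pos by (auto intro!: mult_mono mult_strict_mono)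
    qed
    ultimately show ?thesis unfolding improvable_def by blast
  qed
qed

end

section \<open>From traces back to supports\<close>

text \<open>The largest family of supports with the given traces. Passing from a family to all sets with one of its traces
preserves the crossing property on \<open>{1..l}\<close> and does not decrease the weight.\<close>

definition with_trace :: "nat \<Rightarrow> nat \<Rightarrow> nat \<Rightarrow> nat set set \<Rightarrow> nat set set" where
  "with_trace m r l \<A> = {S \<in> supports m r. S \<inter> {1..l} \<in> \<A>}"

definition traces :: "nat \<Rightarrow> nat set set \<Rightarrow> nat set set" where
  "traces l \<F> = (\<lambda>S. S \<inter> {1..l}) ` \<F>"

lemma weight_with_trace_family:
  assumes "\<A> \<subseteq> Pow {1..l}" "{} \<notin> \<A>" "l \<le> m" "1 \<le> r"
  shows "real (weight r (with_trace m r l \<A>)) = mass (\<lambda>i. real (trace_weight m r l i)) \<A>"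
proof -
  let ?P = "\<lambda>E. {S \<in> supports m r. S \<inter> {1..l} = E}"
  have fin: "finite \<A>" using finite_subset[OF assms(1)] by simp
  have "weight r (with_trace m r l \<A>) = (\<Sum>S\<in>(\<Union>E\<in>\<A>. ?P E). (r - 1) choose (card S - 1))"
    unfolding weight_def by (rule sum.cong) (auto simp: with_trace_def)
  also have "\<dots> = (\<Sum>E\<in>\<A>. weight r (?P E))"
    unfolding weight_def
    by (rule sum.UNION_disjoint[OF fin]) (auto intro: finite_subset[OF _ finite_supports])
  also have "\<dots> = (\<Sum>E\<in>\<A>. trace_weight m r l (card E))"
  proof (rule sum.cong)
    fix E assume "E \<in> \<A>"
    then have "E \<subseteq> {1..l}" "E \<noteq> {}" using assms by auto
    then show "weight r (?P E) = trace_weight m r l (card E)"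
      using weight_with_trace[of "{1..l}" m E r] assms by simp
  qed simp
  finally show ?thesis by (simp add: mass_def)
qed

lemma crossing_mono: "crossing k t \<F> \<G> \<Longrightarrow> k \<le> l \<Longrightarrow> crossing l t \<F> \<G>"
  unfolding crossing_def
proof (intro ballI)
  fix A B assume *: "\<forall>A\<in>\<F>. \<forall>B\<in>\<G>. t \<le> card (A \<inter> B \<inter> {1..k})" "k \<le> l" "A \<in> \<F>" "B \<in> \<G>"
  have "card (A \<inter> B \<inter> {1..k}) \<le> card (A \<inter> B \<inter> {1..l})" using *(2) by (intro card_mono) auto
  then show "t \<le> card (A \<inter> B \<inter> {1..l})" using *(1,3,4) by force
qed

lemma meet_traces: "k \<le> l \<Longrightarrow> (A \<inter> {1..l}) \<inter> (B \<inter> {1..l}) \<inter> {1..k} = A \<inter> B \<inter> {1..k::nat}"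
  by auto

lemma crossing_traces: "k \<le> l \<Longrightarrow> crossing k t (traces l \<F>) (traces l \<G>) \<longleftrightarrow> crossing k t \<F> \<G>"
  unfolding crossing_def traces_def by (simp add: meet_traces del: One_nat_def)

lemma crossing_with_trace:
  assumes "k \<le> l" "crossing k t \<A> \<B>"
  shows "crossing k t (with_trace m r l \<A>) (with_trace n s l \<B>)"
  unfolding crossing_def
proof (intro ballI)
  fix A B assume "A \<in> with_trace m r l \<A>" "B \<in> with_trace n s l \<B>"
  then have "t \<le> card ((A \<inter> {1..l}) \<inter> (B \<inter> {1..l}) \<inter> {1..k})"
    using assms(2) unfolding crossing_def with_trace_def by blast
  then show "t \<le> card (A \<inter> B \<inter> {1..k})" by (simp only: meet_traces[OF assms(1)])
qed

lemma crossing_no_empty: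
  assumes "crossing k t \<A> \<B>" "1 \<le> t" "\<B> \<noteq> {}"
  shows "{} \<notin> \<A>"
  using assms unfolding crossing_def by fastforce

lemma shifted_traces:
  assumes "shifted \<F>"
  shows "shifted (traces l \<F>)"
  unfolding shifted_def traces_def
proof (intro allI ballI impI, elim imageE)
  fix i j :: nat and E S assume ij: "1 \<le> i \<and> i < j" and S: "E = S \<inter> {1..l}" "S \<in> \<F>"
  show "shift i j E \<in> (\<lambda>S. S \<inter> {1..l}) ` \<F>"
  proof (cases "j \<le> l")
    case True
    have "shift i j E = shift i j S \<inter> {1..l}" unfolding S(1) using ij True by (auto simp: shift_def)
    moreover have "shift i j S \<in> \<F>" using assms ij S(2) unfolding shifted_def by blast
    ultimately show ?thesis by blast
  next
    case False
    then have "shift i j E = S \<inter> {1..l}" unfolding S(1) by (simp add: shift_def)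
    then show ?thesis using S(2) by blast
  qed
qed

lemma weight_traces:
  assumes "\<F> \<subseteq> supports m r" "{} \<notin> traces l \<F>" "l \<le> m" "1 \<le> r"
  shows "real (weight r \<F>) \<le> mass (\<lambda>i. real (trace_weight m r l i)) (traces l \<F>)"
proof -
  have "weight r \<F> \<le> weight r (with_trace m r l (traces l \<F>))"
    by (rule weight_mono) (use assms(1) in \<open>auto simp: with_trace_def traces_def\<close>)
  then show ?thesis
    by (subst weight_with_trace_family[symmetric]) (use assms in \<open>auto simp: traces_def\<close>)
qed

lemma card_trace_le: "\<F> \<subseteq> supports m r \<Longrightarrow> E \<in> traces l \<F> \<Longrightarrow> card E \<le> r"
proof -
  assume "\<F> \<subseteq> supports m r" "E \<in> traces l \<F>"
  then obtain S where S: "E = S \<inter> {1..l}" "S \<in> supports m r" by (auto simp: traces_def)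
  then have "card E \<le> card S" using supports_finite[OF S(2)] by (intro card_mono) auto
  then show ?thesis using S(2) by (simp add: supports_def)
qed

text \<open>The exchange for traces, translated to supports. A critical pair of traces has sizes \<open>i \<le> r\<close> and
\<open>j \<le> s\<close> with \<open>i + j = l + t\<close>, so \<open>l - i \<le> s - t\<close> and \<open>l - j \<le> r - t\<close>; this is how the lower bound on \<open>min m n\<close>
yields the ratio \<open>c = t + u\<close>.\<close>

lemma lower_crossing_level:
  fixes u :: real
  assumes t: "1 \<le> t" "t \<le> r" "r \<le> s" and u: "u \<ge> 0" "u > (6 - real t) / 3"
    and mn: "real (min m n) \<ge> (real t + u + 1) * (real s - real t) + real r - real t"
    and l: "t < l" "l \<le> m" "l \<le> n"
    and FG: "\<F> \<subseteq> supports m r" "\<G> \<subseteq> supports n s"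
    and sh: "shifted \<F>" "shifted \<G>"
    and cross: "crossing l t \<F> \<G>" and not_cross: "\<not> crossing (l - 1) t \<F> \<G>"
    and optimal: "\<And>\<F>' \<G>'. \<lbrakk>\<F>' \<subseteq> supports m r; \<G>' \<subseteq> supports n s; crossing l t \<F>' \<G>'\<rbrakk>
      \<Longrightarrow> weight r \<F>' * weight s \<G>' \<le> weight r \<F> * weight s \<G>"
  shows "\<exists>\<F>' \<G>'. \<F>' \<subseteq> supports m r \<and> \<G>' \<subseteq> supports n s \<and> crossing (l - 1) t \<F>' \<G>'
    \<and> weight r \<F> * weight s \<G> \<le> weight r \<F>' * weight s \<G>'
    \<and> (0 < u \<longrightarrow> weight r \<F> * weight s \<G> < weight r \<F>' * weight s \<G>')"
proof -
  define g h where "g = (\<lambda>i. real (trace_weight m r l i))" and "h = (\<lambda>i. real (trace_weight n s l i))"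
  let ?\<A> = "traces l \<F>" and ?\<B> = "traces l \<G>"
  have cr: "crossing l t ?\<A> ?\<B>" using cross by (simp add: crossing_traces)
  have ne: "\<F> \<noteq> {}" "\<G> \<noteq> {}" using not_cross by (auto simp: crossing_def)
  then have "?\<A> \<noteq> {}" "?\<B> \<noteq> {}" by (auto simp: traces_def)
  then have no_empty: "{} \<notin> ?\<A>" "{} \<notin> ?\<B>"
    using crossing_no_empty[OF cr t(1)] crossing_no_empty[OF crossing_sym[OF cr] t(1)] by auto
  have sub: "?\<A> \<subseteq> Pow {1..l}" "?\<B> \<subseteq> Pow {1..l}" by (auto simp: traces_def)
  have finE: "finite E" if "E \<in> ?\<A> \<or> E \<in> ?\<B>" for E using that by (auto simp: traces_def)
  have le: "real (weight r \<F>) \<le> mass g ?\<A>" "real (weight s \<G>) \<le> mass h ?\<B>"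
    unfolding g_def h_def using weight_traces FG no_empty l t by auto
  have trace_value: "real (weight r (with_trace m r l \<A>') * weight s (with_trace n s l \<B>')) = mass g \<A>' * mass h \<B>'"
    if "\<A>' \<subseteq> Pow {1..l}" "\<B>' \<subseteq> Pow {1..l}" "crossing k t \<A>' \<B>'" "\<A>' \<noteq> {}" "\<B>' \<noteq> {}" for \<A>' \<B>' k
    unfolding g_def h_def using that crossing_no_empty[OF that(3) t(1)] crossing_no_empty[OF crossing_sym[OF that(3)] t(1)]
      weight_with_trace_family[of \<A>' l m r] weight_with_trace_family[of \<B>' l n s] l t by simp
  have prod_le: "real (weight r \<F> * weight s \<G>) \<le> mass g ?\<A> * mass h ?\<B>"
    using mult_mono[OF le] by (simp add: g_def h_def mass_def sum_nonneg)
  have within: "with_trace m r l \<A>' \<subseteq> supports m r" "with_trace n s l \<A>' \<subseteq> supports n s" for \<A>'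
    by (auto simp: with_trace_def)
  define c where "c = real t + u"
  interpret trace_pair l t c g h ?\<A> ?\<B>
  proof
    show "real t \<le> c" "2 + 2 * real t / 3 < c" using u by (auto simp: c_def field_simps)
    show "shifted ?\<A>" "shifted ?\<B>" using sh by (auto intro: shifted_traces)
    show "\<not> crossing (l - 1) t ?\<A> ?\<B>" using not_cross by (simp add: crossing_traces)
    show "0 \<le> g i" "0 \<le> h i" for i by (auto simp: g_def h_def)
    show "0 < g (card E)" if "E \<in> ?\<A>" for E
      using that trace_weight_pos[of "card E" r m l] card_trace_le[OF FG(1) that] no_empty finE[of E]
      by (auto simp: g_def Suc_le_eq card_gt_0_iff)
    show "0 < h (card E)" if "E \<in> ?\<B>" for E
      using that trace_weight_pos[of "card E" s n l] card_trace_le[OF FG(2) that] no_empty finE[of E]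
      by (auto simp: h_def Suc_le_eq card_gt_0_iff)
    fix E F assume E: "E \<in> ?\<A>" and F: "F \<in> ?\<B>" and sum: "card E + card F = l + t"
    have le: "card E \<le> r" "card F \<le> s" using card_trace_le FG E F by auto
    have sumr: "real (card E) + real (card F) = real l + real t" using sum by linarith
    have c0: "0 \<le> c" using u by (simp add: c_def)
    have mn': "real m \<ge> (c + 1) * (real s - real t) + (real r - real t)"
       "real n \<ge> (c + 1) * (real s - real t) + (real r - real t)" using mn by (auto simp: c_def)
    show "c * g (card E) \<le> g (card E - 1)" if "t < card E"
      unfolding g_def
    proof (rule trace_weight_ratio)
      have "c * (real r - real (card E) + 1) \<le> c * (real s - real t)"
        using that t c0 by (intro mult_left_mono) auto
      moreover have "real l - real (card E) \<le> real s - real t" using sumr le by simp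
      ultimately show "c * (real r - real (card E) + 1) \<le> real m - real l + real (card E) - 1"
        using mn'(1) le that by (simp add: algebra_simps)
    qed (use that t le l c0 in auto)
    show "c * h (card F) \<le> h (card F - 1)" if "t < card F"
      unfolding h_def
    proof (rule trace_weight_ratio)
      have "c * (real s - real (card F) + 1) \<le> c * (real s - real t)"
        using that c0 by (intro mult_left_mono) auto
      moreover have "real l - real (card F) \<le> real r - real t" using sumr le by simp
      ultimately show "c * (real s - real (card F) + 1) \<le> real n - real l + real (card F) - 1"
        using mn'(2) le that by (simp add: algebra_simps)
    qed (use that t le l c0 in auto)
  next
    fix \<A>' \<B>' assume *: "\<A>' \<subseteq> Pow {1..l}" "\<B>' \<subseteq> Pow {1..l}" "crossing l t \<A>' \<B>'"
    show "mass g \<A>' * mass h \<B>' \<le> mass g ?\<A> * mass h ?\<B>"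
    proof (cases "\<A>' = {} \<or> \<B>' = {}")
      case True
      then have "mass g \<A>' * mass h \<B>' = 0" by (auto simp: mass_def)
      moreover have "0 \<le> mass g ?\<A> * mass h ?\<B>" by (simp add: g_def h_def mass_def sum_nonneg)
      ultimately show ?thesis by linarith
    next
      case False
      have "weight r (with_trace m r l \<A>') * weight s (with_trace n s l \<B>') \<le> weight r \<F> * weight s \<G>"
        by (rule optimal[OF within crossing_with_trace[OF order.refl *(3)]])
      then have "real (weight r (with_trace m r l \<A>') * weight s (with_trace n s l \<B>')) \<le> real (weight r \<F> * weight s \<G>)"
        by (rule of_nat_mono)
      then show ?thesis using trace_value[OF *] False prod_le by simp
    qed
  qed (use t l sub cr in auto)
  interpret sw: trace_pair l t c h g ?\<B> ?\<A> by (rule swap)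
  obtain \<A>' \<B>' where new: "\<A>' \<subseteq> Pow {1..l}" "\<B>' \<subseteq> Pow {1..l}" "crossing (l - 1) t \<A>' \<B>'"
      and ge: "mass g ?\<A> * mass h ?\<B> \<le> mass g \<A>' * mass h \<B>'"
      and gt: "real t < c \<Longrightarrow> mass g ?\<A> * mass h ?\<B> < mass g \<A>' * mass h \<B>'"
    using improvable unfolding improvable_def by blast
  have "0 < mass g \<A>' * mass h \<B>'" using ge mult_pos_pos[OF mass_pos sw.mass_pos] by linarith
  then have "\<A>' \<noteq> {}" "\<B>' \<noteq> {}" by (auto simp: mass_def)
  then have eq: "real (weight r (with_trace m r l \<A>') * weight s (with_trace n s l \<B>')) = mass g \<A>' * mass h \<B>'"
    by (rule trace_value[OF new])
  show ?thesis
  proof (intro exI conjI impI)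
    show "with_trace m r l \<A>' \<subseteq> supports m r" "with_trace n s l \<B>' \<subseteq> supports n s" by (rule within)+
    show "crossing (l - 1) t (with_trace m r l \<A>') (with_trace n s l \<B>')"
      by (rule crossing_with_trace[OF _ new(3)]) simp
    show "weight r \<F> * weight s \<G> \<le> weight r (with_trace m r l \<A>') * weight s (with_trace n s l \<B>')"
      using prod_le ge eq by linarith
    show "weight r \<F> * weight s \<G> < weight r (with_trace m r l \<A>') * weight s (with_trace n s l \<B>')" if "0 < u"
      using prod_le gt eq that unfolding c_def by linarith
  qed
qed

section \<open>The maximum product for families of supports\<close>

lemma star_supports: "star m r T \<subseteq> supports m r"
  by (auto simp: star_def)

lemma crossing_low_level:
  assumes "crossing l t \<F> \<G>" "l \<le> t" "\<F> \<subseteq> supports m r" "\<G> \<subseteq> supports n s" "\<F> \<noteq> {}" "\<G> \<noteq> {}"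
  shows "\<F> \<subseteq> star m r {1..t}" "\<G> \<subseteq> star n s {1..t}" "{1..t} \<subseteq> {1..m}" "{1..t} \<subseteq> {1..n}"
proof -
  have sub: "{1..t} \<subseteq> A \<inter> B" if "A \<in> \<F>" "B \<in> \<G>" for A B
  proof -
    have "t \<le> card (A \<inter> B \<inter> {1..l})" using assms(1) that by (auto simp: crossing_def)
    moreover have "card (A \<inter> B \<inter> {1..l}) \<le> card (A \<inter> B \<inter> {1..t})" using assms(2) by (intro card_mono) auto
    ultimately have "A \<inter> B \<inter> {1..t} = {1..t}" by (intro card_seteq) auto
    then show ?thesis by blast
  qed
  show F: "\<F> \<subseteq> star m r {1..t}" and G: "\<G> \<subseteq> star n s {1..t}"
    using sub assms(3-6) unfolding star_def by blast+
  show "{1..t} \<subseteq> {1..m}" "{1..t} \<subseteq> {1..n}"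
    using F G assms(5,6) unfolding star_def supports_def by blast+
qed

locale sizes =
  fixes m n r s t :: nat and u :: real
  assumes t: "1 \<le> t" "t \<le> r" "r \<le> s" and u: "u \<ge> 0" "u > (6 - real t) / 3"
    and mn: "real (min m n) \<ge> (real t + u + 1) * (real s - real t) + real r - real t"
begin

abbreviation bound :: nat where
  "bound \<equiv> ((m + r - t - 1) choose (r - t)) * ((n + s - t - 1) choose (s - t))"

definition crossing_pairs :: "nat \<Rightarrow> (nat set set \<times> nat set set) set" where
  "crossing_pairs l = {(\<F>, \<G>). \<F> \<subseteq> supports m r \<and> \<G> \<subseteq> supports n s \<and> crossing l t \<F> \<G>}"

definition weights :: "nat set set \<times> nat set set \<Rightarrow> nat" where
  "weights P = weight r (fst P) * weight s (snd P)"

lemma crossing_pairs_mono: "k \<le> l \<Longrightarrow> crossing_pairs k \<subseteq> crossing_pairs l"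
  by (auto simp: crossing_pairs_def intro: crossing_mono)

lemma finite_crossing_pairs: "finite (crossing_pairs l)"
  by (rule finite_subset[of _ "Pow (supports m r) \<times> Pow (supports n s)"])
    (auto simp: crossing_pairs_def finite_supports)

lemma weight_star_interval:
  assumes "{1..t} \<subseteq> {1..m}" "{1..t} \<subseteq> {1..n}"
  shows "weight r (star m r {1..t}) = (m + r - t - 1) choose (r - t)"
    "weight s (star n s {1..t}) = (n + s - t - 1) choose (s - t)"
  using weight_star[OF assms(1), of r] weight_star[OF assms(2), of s] t by auto

text \<open>Among the pairs of maximum product, one with least \<open>l\<close>, and among these one with least total, is shifted. If \<open>t < l\<close>,
the exchange would give a pair of maximum product that crosses below \<open>l\<close>.\<close>

lemma weights_le_bound:
  assumes "P \<in> crossing_pairs (min m n)"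
  shows "weights P \<le> bound"
proof -
  define V where "V = Max (weights ` crossing_pairs (min m n))"
  have le_V: "weights Q \<le> V" if "Q \<in> crossing_pairs (min m n)" for Q
    unfolding V_def using that finite_crossing_pairs by (intro Max_ge) auto
  have "V \<in> weights ` crossing_pairs (min m n)"
    unfolding V_def using assms finite_crossing_pairs by (intro Max_in) auto
  then have ex: "\<exists>Q\<in>crossing_pairs (min m n). weights Q = V" by blast
  define l where "l = (LEAST l. \<exists>Q\<in>crossing_pairs l. weights Q = V)"
  have "\<exists>Q\<in>crossing_pairs l. weights Q = V"
    unfolding l_def by (rule LeastI[where P = "\<lambda>l. \<exists>Q\<in>crossing_pairs l. weights Q = V", OF ex])
  moreover have l_mn: "l \<le> min m n" unfolding l_def by (rule Least_le) (rule ex)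
  ultimately obtain Q where Q: "Q \<in> crossing_pairs l \<and> weights Q = V"
    and least: "\<And>Q'. Q' \<in> crossing_pairs l \<and> weights Q' = V
      \<Longrightarrow> total (fst Q) + total (snd Q) \<le> total (fst Q') + total (snd Q')"
    using ex_has_least_nat[of "\<lambda>Q. Q \<in> crossing_pairs l \<and> weights Q = V" _ "\<lambda>Q. total (fst Q) + total (snd Q)"]
    by metis
  obtain \<F> \<G> where FG: "Q = (\<F>, \<G>)" by fastforce
  have sub: "\<F> \<subseteq> supports m r" "\<G> \<subseteq> supports n s" and cross: "crossing l t \<F> \<G>"
    using Q by (auto simp: FG crossing_pairs_def)
  have val: "weight r \<F> * weight s \<G> = V" using Q by (simp add: FG weights_def)
  have opt: "weight r \<F>' * weight s \<G>' \<le> V"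
    if "\<F>' \<subseteq> supports m r" "\<G>' \<subseteq> supports n s" "crossing l t \<F>' \<G>'" for \<F>' \<G>'
    using le_V[of "(\<F>', \<G>')"] crossing_pairs_mono[OF l_mn] that
    by (auto simp: crossing_pairs_def weights_def)
  have sh: "shifted \<F> \<and> shifted \<G>"
  proof (rule ccontr)
    assume "\<not> (shifted \<F> \<and> shifted \<G>)"
    from not_shiftedE[OF this sub] obtain i j where ij: "1 \<le> i" "i < j"
      and less: "total (shift_family i j \<F>) + total (shift_family i j \<G>) < total \<F> + total \<G>" by metis
    have "(shift_family i j \<F>, shift_family i j \<G>) \<in> crossing_pairs l"
      unfolding crossing_pairs_def
      using shift_family_supports sub ij crossing_shift_family[OF ij cross] by auto
    moreover have "weights (shift_family i j \<F>, shift_family i j \<G>) = V"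
      using weight_shift_family[OF sub(1), of i j] weight_shift_family[OF sub(2), of i j] ij(2) val
      by (simp add: weights_def)
    ultimately show False using least less by (fastforce simp: FG)
  qed
  have "V \<le> bound"
  proof (cases "t < l")
    case True
    have "\<not> crossing (l - 1) t \<F> \<G>"
    proof
      assume "crossing (l - 1) t \<F> \<G>"
      then have "\<exists>Q\<in>crossing_pairs (l - 1). weights Q = V"
        using sub val by (intro bexI[of _ "(\<F>, \<G>)"]) (auto simp: crossing_pairs_def weights_def)
      then have "l \<le> l - 1" unfolding l_def by (rule Least_le)
      then show False using True by simp
    qed
    from lower_crossing_level[OF t u mn True _ _ sub sh[THEN conjunct1] sh[THEN conjunct2] cross this]
    obtain \<F>' \<G>' where new: "\<F>' \<subseteq> supports m r" "\<G>' \<subseteq> supports n s" "crossing (l - 1) t \<F>' \<G>'"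
      and ge: "V \<le> weight r \<F>' * weight s \<G>'"
      using l_mn opt val by auto
    have "weight r \<F>' * weight s \<G>' = V"
      using opt[OF new(1,2) crossing_mono[OF new(3)]] ge by simp
    then have "\<exists>Q\<in>crossing_pairs (l - 1). weights Q = V"
      using new by (intro bexI[of _ "(\<F>', \<G>')"]) (auto simp: crossing_pairs_def weights_def)
    then have "l \<le> l - 1" unfolding l_def by (rule Least_le)
    then show ?thesis using True by simp
  next
    case False
    show ?thesis
    proof (cases "\<F> = {} \<or> \<G> = {}")
      case True then show ?thesis using val by (auto simp: weight_def)
    next
      case ne: False
      then have low: "\<F> \<subseteq> star m r {1..t}" "\<G> \<subseteq> star n s {1..t}" "{1..t} \<subseteq> {1..m}" "{1..t} \<subseteq> {1..n}"
        using crossing_low_level[OF cross _ sub] False by auto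
      have "weight r \<F> * weight s \<G> \<le> weight r (star m r {1..t}) * weight s (star n s {1..t})"
        by (intro mult_le_mono weight_mono[OF _ star_supports] low)
      then show ?thesis using weight_star_interval[OF low(3,4)] val by simp
    qed
  qed
  then show ?thesis using le_V[OF assms] by simp
qed

text \<open>Induction along shifts: a shifted extremal pair is a pair of stars since any exchange would exceed
the bound, and being a pair of stars is inherited by the pair before the shift.\<close>

lemma stars_if_weights_eq_bound:
  assumes "0 < u" "1 \<le> m" "1 \<le> n"
    and "(\<F>, \<G>) \<in> crossing_pairs (min m n)" "weights (\<F>, \<G>) = bound"
  shows "\<exists>T. T \<subseteq> {1..m} \<and> T \<subseteq> {1..n} \<and> card T = t \<and> \<F> = star m r T \<and> \<G> = star n s T"
  using assms(4,5)
proof (induction "total \<F> + total \<G>" arbitrary: \<F> \<G> rule: less_induct)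
  case less
  have sub: "\<F> \<subseteq> supports m r" "\<G> \<subseteq> supports n s" and cross: "crossing (min m n) t \<F> \<G>"
    using less.prems by (auto simp: crossing_pairs_def)
  have val: "weight r \<F> * weight s \<G> = bound" using less.prems by (simp add: weights_def)
  have "r - t \<le> m + r - t - 1" "s - t \<le> n + s - t - 1" using assms(2,3) t by auto
  then have pos: "0 < (m + r - t - 1) choose (r - t)" "0 < (n + s - t - 1) choose (s - t)" by auto
  then have nz: "weight r \<F> * weight s \<G> \<noteq> 0" using val by simp
  then have ne: "\<F> \<noteq> {}" "\<G> \<noteq> {}" by (auto simp: weight_def)
  show ?case
  proof (cases "shifted \<F> \<and> shifted \<G>")
    case False
    from not_shiftedE[OF False sub] obtain i j where ij: "1 \<le> i" "i < j"
      and less': "total (shift_family i j \<F>) + total (shift_family i j \<G>) < total \<F> + total \<G>" by metis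
    have wt: "weight r (shift_family i j \<F>) = weight r \<F>" "weight s (shift_family i j \<G>) = weight s \<G>"
      using weight_shift_family[OF sub(1)] weight_shift_family[OF sub(2)] ij(2) by auto
    have "(shift_family i j \<F>, shift_family i j \<G>) \<in> crossing_pairs (min m n)"
      unfolding crossing_pairs_def
      using shift_family_supports sub ij crossing_shift_family[OF ij cross] by auto
    from less.hyps[OF less' this] obtain T where T: "T \<subseteq> {1..m}" "T \<subseteq> {1..n}" "card T = t"
      "shift_family i j \<F> = star m r T" "shift_family i j \<G> = star n s T"
      using wt val by (auto simp: weights_def)
    have Tne: "T \<noteq> {}" using T(3) t(1) by auto
    have wF: "weight r \<F> = (m + r - t - 1) choose (r - t)"
      using weight_star[OF T(1) Tne, of r] T(3,4) wt(1) t by simp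
    have wG: "weight s \<G> = (n + s - t - 1) choose (s - t)"
      using weight_star[OF T(2) Tne, of s] T(3,5) wt(2) t by simp
    have "T \<in> star m r T" using T(1,3) Tne t by (simp add: star_def supports_def)
    then obtain S where S: "S \<in> \<F>" "T = shift_within \<F> i j S"
      unfolding T(4)[symmetric] by (auto simp: shift_family_def)
    have "finite S" using S(1) sub(1) supports_finite by blast
    then have "card S = t" using card_shift_within S(2) T(3) by simp
    then show ?thesis
      using stars_if_small_member[OF cross sub S(1) _ t(1,2) _ wF wG ne(2)] t by auto
  next
    case sh: True
    define l where "l = (LEAST l. crossing l t \<F> \<G>)"
    have l: "crossing l t \<F> \<G>" unfolding l_def using cross by (rule LeastI)
    have l_mn: "l \<le> min m n" unfolding l_def using cross by (rule Least_le)
    have "\<not> t < l"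
    proof
      assume tl: "t < l"
      have "\<not> crossing (l - 1) t \<F> \<G>" using not_less_Least[of "l - 1" "\<lambda>l. crossing l t \<F> \<G>"] tl
        unfolding l_def[symmetric] by simp
      moreover have opt: "weight r \<F>' * weight s \<G>' \<le> weight r \<F> * weight s \<G>"
        if "\<F>' \<subseteq> supports m r" "\<G>' \<subseteq> supports n s" "crossing k t \<F>' \<G>'" "k \<le> l" for \<F>' \<G>' k
        using weights_le_bound[of "(\<F>', \<G>')"] crossing_mono[OF that(3), of "min m n"] that l_mn val
        by (auto simp: crossing_pairs_def weights_def)
      ultimately obtain \<F>' \<G>' where new: "\<F>' \<subseteq> supports m r" "\<G>' \<subseteq> supports n s" "crossing (l - 1) t \<F>' \<G>'"
        and gt: "weight r \<F> * weight s \<G> < weight r \<F>' * weight s \<G>'"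
        using lower_crossing_level[OF t u mn tl _ _ sub sh[THEN conjunct1] sh[THEN conjunct2] l] l_mn assms(1)
        by (metis le_refl min.bounded_iff)
      then show False using opt[OF new] by simp
    qed
    then have low: "\<F> \<subseteq> star m r {1..t}" "\<G> \<subseteq> star n s {1..t}" "{1..t} \<subseteq> {1..m}" "{1..t} \<subseteq> {1..n}"
      using crossing_low_level[OF l _ sub ne] by auto
    note ws = weight_star_interval[OF low(3,4)]
    have le: "weight r \<F> \<le> weight r (star m r {1..t})" "weight s \<G> \<le> weight s (star n s {1..t})"
      by (intro weight_mono[OF _ star_supports] low)+
    have geF: "weight r (star m r {1..t}) \<le> weight r \<F>"
    proof (rule ccontr)
      assume "\<not> ?thesis"
      then have "weight r \<F> * weight s \<G> < weight r (star m r {1..t}) * weight s (star n s {1..t})"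
        using le(2) nz by (intro mult_less_le_imp_less) auto
      then show False using val ws by simp
    qed
    have geG: "weight s (star n s {1..t}) \<le> weight s \<G>"
    proof (rule ccontr)
      assume "\<not> ?thesis"
      then have "weight r \<F> * weight s \<G> < weight r (star m r {1..t}) * weight s (star n s {1..t})"
        using le(1) nz by (intro mult_le_less_imp_less) auto
      then show False using val ws by simp
    qed
    show ?thesis
      using weight_subset_eq[OF low(1) star_supports geF] weight_subset_eq[OF low(2) star_supports geG] low(3,4)
      by (intro exI[of _ "{1..t}"] conjI) simp_all
  qed
qed

end

section \<open>Cross-intersecting families of multisets\<close>

lemma multisets_star:
  assumes "1 \<le> r"
  shows "{A \<in> multisets m r. T \<subseteq> set A} = {A \<in> multisets m r. set A \<in> star m r T}"
  using set_in_supports assms by (auto simp: star_def)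

lemma card_multisets_containing:
  assumes "T \<subseteq> {1..m}" "card T = t" "1 \<le> t" "t \<le> r"
  shows "card {A \<in> multisets m r. T \<subseteq> set A} = (m + r - t - 1) choose (r - t)"
proof -
  have "1 \<le> r" "T \<noteq> {}" using assms by auto
  then show ?thesis
    unfolding multisets_star[OF \<open>1 \<le> r\<close>]
    using card_multisets_with_support_in[OF _ star_supports] weight_star[OF assms(1)] assms by simp
qed

lemma multisets_of_supports:
  assumes "\<A> \<subseteq> multisets m r" "1 \<le> r"
  shows "set ` \<A> \<subseteq> supports m r" "\<A> \<subseteq> {A \<in> multisets m r. set A \<in> set ` \<A>}" "card \<A> \<le> weight r (set ` \<A>)"
proof -
  show sup: "set ` \<A> \<subseteq> supports m r" using assms set_in_supports by blast
  show sub: "\<A> \<subseteq> {A \<in> multisets m r. set A \<in> set ` \<A>}" using assms by blast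
  show "card \<A> \<le> weight r (set ` \<A>)"
    using card_mono[OF _ sub] card_multisets_with_support_in[OF assms(2) sup] finite_multisets[of m r] by simp
qed

theorem theorem1p6:
  fixes m n r s t :: nat and u :: real and \<A> \<B> :: "nat list set"
  assumes "m \<ge> 1" and "n \<ge> 1" and "1 \<le> t" and "t \<le> r" and "r \<le> s"
    and "u \<ge> 0" and "u > (6 - real t) / 3"
    and "real (min m n) \<ge> (real t + u + 1) * (real s - real t) + real r - real t"
    and "\<A> \<subseteq> multisets m r" and "\<B> \<subseteq> multisets n s"
    and "cross_intersecting t \<A> \<B>"
  shows "card \<A> * card \<B> \<le> ((m + r - t - 1) choose (r - t)) * ((n + s - t - 1) choose (s - t))
    \<and> (u > 0 \<longrightarrow>
        (card \<A> * card \<B> = ((m + r - t - 1) choose (r - t)) * ((n + s - t - 1) choose (s - t))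
         \<longleftrightarrow> (\<exists>T. T \<subseteq> {1..min m n} \<and> card T = t
               \<and> \<A> = {A \<in> multisets m r. T \<subseteq> set A}
               \<and> \<B> = {B \<in> multisets n s. T \<subseteq> set B})))"
proof -
  interpret sizes m n r s t u by unfold_locales (fact assms)+
  have rs: "1 \<le> r" "1 \<le> s" using assms by auto
  note A = multisets_of_supports[OF assms(9) rs(1)] and B = multisets_of_supports[OF assms(10) rs(2)]
  have "crossing (min m n) t (set ` \<A>) (set ` \<B>)"
    unfolding crossing_def
  proof (intro ballI, elim imageE, simp only:)
    fix a b assume ab: "a \<in> \<A>" "b \<in> \<B>"
    then have "set a \<subseteq> {1..m}" "set b \<subseteq> {1..n}"
      using assms(9,10) unfolding multisets_def by blast+
    then have "set a \<inter> set b \<inter> {1..min m n} = set a \<inter> set b" by fastforce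
    then show "t \<le> card (set a \<inter> set b \<inter> {1..min m n})"
      using assms(11) ab by (simp add: cross_intersecting_def)
  qed
  then have pair: "(set ` \<A>, set ` \<B>) \<in> crossing_pairs (min m n)"
    using A(1) B(1) by (simp add: crossing_pairs_def)
  have le: "card \<A> * card \<B> \<le> weights (set ` \<A>, set ` \<B>)"
    unfolding weights_def using mult_le_mono[OF A(3) B(3)] by simp
  note le_bound = weights_le_bound[OF pair]
  have extremal: "\<exists>T. T \<subseteq> {1..min m n} \<and> card T = t \<and> \<A> = {A \<in> multisets m r. T \<subseteq> set A}
      \<and> \<B> = {B \<in> multisets n s. T \<subseteq> set B}" if u0: "u > 0" and eq: "card \<A> * card \<B> = bound"
  proof -
    obtain T where T: "T \<subseteq> {1..m}" "T \<subseteq> {1..n}" "card T = t" "set ` \<A> = star m r T" "set ` \<B> = star n s T"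
      using stars_if_weights_eq_bound[OF u0 assms(1,2) pair] le le_bound eq by auto
    let ?A = "{A \<in> multisets m r. T \<subseteq> set A}" and ?B = "{B \<in> multisets n s. T \<subseteq> set B}"
    have AB: "\<A> \<subseteq> ?A" "\<B> \<subseteq> ?B"
      using A(2) B(2) unfolding T(4,5) multisets_star[OF rs(1)] multisets_star[OF rs(2)] .
    have fin: "finite ?A" "finite ?B" using finite_multisets by auto
    have cards: "card ?A * card ?B = bound"
      using card_multisets_containing T(1-3) t by simp
    have "r - t \<le> m + r - t - 1" "s - t \<le> n + s - t - 1" using assms by auto
    then have "0 < bound" by simp
    have le: "card \<A> \<le> card ?A" "card \<B> \<le> card ?B" using card_mono fin AB by auto
    have "card ?A \<le> card \<A>" "card ?B \<le> card \<B>"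
    proof (rule_tac [!] ccontr)
      assume "\<not> card ?A \<le> card \<A>"
      then have "card \<A> * card \<B> < card ?A * card ?B"
        using le(2) eq \<open>0 < bound\<close> by (intro mult_less_le_imp_less) (auto intro: gr0I)
      then show False using eq cards by simp
    next
      assume "\<not> card ?B \<le> card \<B>"
      then have "card \<A> * card \<B> < card ?A * card ?B"
        using le(1) eq \<open>0 < bound\<close> by (intro mult_le_less_imp_less) (auto intro: gr0I)
      then show False using eq cards by simp
    qed
    then have "\<A> = ?A" "\<B> = ?B"
      using card_seteq[OF fin(1) AB(1)] card_seteq[OF fin(2) AB(2)] by blast+
    moreover have "T \<subseteq> {1..min m n}" using T(1,2) by fastforce
    ultimately show ?thesis using T(3) by blast
  qed
  have attained: "card \<A> * card \<B> = bound" if "\<exists>T. T \<subseteq> {1..min m n} \<and> card T = t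
      \<and> \<A> = {A \<in> multisets m r. T \<subseteq> set A} \<and> \<B> = {B \<in> multisets n s. T \<subseteq> set B}"
  proof -
    from that obtain T where T: "T \<subseteq> {1..min m n}" "card T = t"
      "\<A> = {A \<in> multisets m r. T \<subseteq> set A}" "\<B> = {B \<in> multisets n s. T \<subseteq> set B}" by blast
    then have "T \<subseteq> {1..m}" "T \<subseteq> {1..n}" by auto
    then show ?thesis using card_multisets_containing T t by simp
  qed
  show ?thesis
  proof (intro conjI impI)
    show "card \<A> * card \<B> \<le> bound" by (rule order_trans[OF le le_bound])
  qed (rule iffI, erule extremal, assumption, erule attained)
qed

end
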